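(* Let $r$ be a positive integer and let $G_1,\dots,G_m$, $H_1,\dots,H_m$ and $G$ be graphs. If $H_i$ has zero $G_i$-slice density for each $i\in[m]$ and $G\xrightarrow{r}\{G_1,\dots,G_m\}$, then $G^{\square N}\xrightarrow{r}\{H_1,\dots,H_m\}$ for every sufficiently large integer $N$. Similarly, if $H_i$ has zero induced $G_i$-slice density for each $i\in[m]$ and $G\xrightarrow{r}_{\mathrm{ind}}\{G_1,\dots,G_m\}$, then $G^{\square N}\xrightarrow{r}_{\mathrm{ind}}\{H_1,\dots,H_m\}$ for every sufficiently large integer $N$.
   Context: Graphs are finite. The Cartesian product $G\square H$ has vertex set $V(G)\times V(H)$, with $(x_1,x_2)(y_1,y_2)$ an edge iff either $x_1y_1\in E(G)$ and $x_2=y_2$, or $x_1=y_1$ and $x_2y_2\in E(H)$; $G^{\square 1}=G$ and $G^{\square N}=G^{\square (N-1)}\square G$. A $G$-slice of $G^{\square N}$ is a subgraph induced by a Cartesian product of $V(G)$ and $N-1$ one-element subsets of $V(G)$, in any order of the coordinates (there are $N|V(G)|^{N-1}$ of them). A graph $H$ has zero (induced) $G$-slice density if for every $\varepsilon>0$ there is $N_0$ such that for every $N\geq N_0$, every subgraph of $G^{\square N}$ that contains at least an $\varepsilon$-fraction of the $G$-slices of $G^{\square N}$ contains an (induced) copy of $H$. For a graph $G$, a family $\mathcal F$ of graphs and a positive integer $r$, $G\xrightarrow{r}\mathcal F$ (resp. $G\xrightarrow{r}_{\mathrm{ind}}\mathcal F$) means that every $r$-coloring of $V(G)$ contains a monochromatic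 copy (resp. induced copy) of some graph in $\mathcal F$. *)

theory Defs
  imports Complex_Main "HOL-Library.FuncSet" "Graph_Theory.Graph_Theory"
begin

text \<open>
  Finite simple graphs are the finite, symmetric, loop-free digraphs without parallel arcs,
  \<^locale>\<open>pair_graph\<close>. The graph with no vertices is allowed.
\<close>

definition cart_prod ::
  "'a pair_pre_digraph \<Rightarrow> 'b pair_pre_digraph \<Rightarrow> ('a \<times> 'b) pair_pre_digraph" where
  "cart_prod G H =
     \<lparr> pverts = pverts G \<times> pverts H,
       parcs = {((x1, x2), (y1, y2)) | x1 x2 y1 y2.
                  (x1, y1) \<in> parcs G \<and> x2 = y2 \<and> x2 \<in> pverts H \<or>
                  x1 = y1 \<and> x1 \<in> pverts G \<and> (x2, y2) \<in> parcs H} \<rparr>"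

definition relabel :: "('a \<Rightarrow> 'b) \<Rightarrow> 'a pair_pre_digraph \<Rightarrow> 'b pair_pre_digraph" where
  "relabel f G = \<lparr> pverts = f ` pverts G, parcs = map_prod f f ` parcs G \<rparr>"

text \<open>
  The vertices of the \<open>N\<close>-th Cartesian power are the lists of length \<open>N\<close> over the vertices of \<open>G\<close>,
  so that all powers live on one type. The recursion starts with the one-vertex graph at exponent 0;
  the first power is then \<open>G\<close> on one-element lists.
\<close>

primrec cart_power :: "'a pair_pre_digraph \<Rightarrow> nat \<Rightarrow> 'a list pair_pre_digraph" where
  "cart_power G 0 = \<lparr> pverts = {[]}, parcs = {} \<rparr>"
| "cart_power G (Suc N) = relabel (\<lambda>(xs, x). xs @ [x]) (cart_prod (cart_power G N) G)"

text \<open>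
  The lists \<open>us\<close> and \<open>vs\<close> hold the \<open>N - 1\<close> fixed coordinates before and after the free one.
  Slices are collected as a set of subgraphs; if \<open>G\<close> has just one vertex, they all coincide, which
  does not affect the fraction of slices contained in a subgraph.
\<close>

definition slices ::
  "'a pair_pre_digraph \<Rightarrow> nat \<Rightarrow> ('a list, 'a list \<times> 'a list) pre_digraph set" where
  "slices G N =
     {with_proj (cart_power G N) \<restriction> ((\<lambda>x. us @ x # vs) ` pverts G) | us vs.
        set us \<subseteq> pverts G \<and> set vs \<subseteq> pverts G \<and> length us + length vs + 1 = N}"

definition is_copy ::
  "'a pair_pre_digraph \<Rightarrow> 'b pair_pre_digraph \<Rightarrow> 'a pair_pre_digraph \<Rightarrow> bool" where
  "is_copy C H G \<longleftrightarrow> subgraph C G \<and> digraph_iso H C"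

definition is_induced_copy ::
  "'a pair_pre_digraph \<Rightarrow> 'b pair_pre_digraph \<Rightarrow> 'a pair_pre_digraph \<Rightarrow> bool" where
  "is_induced_copy C H G \<longleftrightarrow> induced_subgraph C G \<and> digraph_iso H C"

definition contains_slice_fraction ::
  "real \<Rightarrow> 'a pair_pre_digraph \<Rightarrow> nat \<Rightarrow> 'a list pair_pre_digraph \<Rightarrow> bool" where
  "contains_slice_fraction \<epsilon> G N K \<longleftrightarrow>
     \<epsilon> * real (card (slices G N)) \<le> real (card {S \<in> slices G N. subgraph S K})"

text \<open>
  The condition \<open>pair_graph K\<close> makes \<open>K\<close> an undirected subgraph: the library notion
  \<^const>\<open>subgraph\<close> on its own would also admit subdigraphs that are not symmetric.
\<close>

definition zero_slice_density :: "'a pair_pre_digraph \<Rightarrow> 'b pair_pre_digraph \<Rightarrow> bool" where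
  "zero_slice_density G H \<longleftrightarrow>
     (\<forall>\<epsilon>>0. \<exists>N0. \<forall>N\<ge>N0. \<forall>K.
        pair_graph K \<and> subgraph K (cart_power G N) \<and> contains_slice_fraction \<epsilon> G N K \<longrightarrow>
        (\<exists>C. is_copy C H K))"

definition zero_induced_slice_density :: "'a pair_pre_digraph \<Rightarrow> 'b pair_pre_digraph \<Rightarrow> bool" where
  "zero_induced_slice_density G H \<longleftrightarrow>
     (\<forall>\<epsilon>>0. \<exists>N0. \<forall>N\<ge>N0. \<forall>K.
        pair_graph K \<and> subgraph K (cart_power G N) \<and> contains_slice_fraction \<epsilon> G N K \<longrightarrow>
        (\<exists>C. is_induced_copy C H K))"

definition arrows :: "nat \<Rightarrow> 'a pair_pre_digraph \<Rightarrow> 'b pair_pre_digraph set \<Rightarrow> bool" where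
  "arrows r G F \<longleftrightarrow>
     (\<forall>c \<in> pverts G \<rightarrow> {1..r}. \<exists>H\<in>F. \<exists>C. is_copy C H G \<and>
        (\<exists>k\<in>{1..r}. \<forall>v\<in>pverts C. c v = k))"

definition induced_arrows :: "nat \<Rightarrow> 'a pair_pre_digraph \<Rightarrow> 'b pair_pre_digraph set \<Rightarrow> bool" where
  "induced_arrows r G F \<longleftrightarrow>
     (\<forall>c \<in> pverts G \<rightarrow> {1..r}. \<exists>H\<in>F. \<exists>C. is_induced_copy C H G \<and>
        (\<exists>k\<in>{1..r}. \<forall>v\<in>pverts C. c v = k))"

lemma cart_power_1: "cart_power G 1 = relabel (\<lambda>x. [x]) G"
proof -
  have "parcs (cart_prod (cart_power G 0) G) = (\<lambda>(x, y). (([], x), ([], y))) ` parcs G"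
    by (auto simp: cart_prod_def)
  moreover have "pverts (cart_prod (cart_power G 0) G) = Pair [] ` pverts G"
    by (auto simp: cart_prod_def)
  ultimately show ?thesis
    by (auto simp: relabel_def image_image map_prod_def split_beta simp del: cart_power.simps(1))
qed

lemma pverts_cart_power: "pverts (cart_power G N) = {xs. set xs \<subseteq> pverts G \<and> length xs = N}"
proof (induction N)
  case (Suc N)
  show ?case
  proof (intro set_eqI iffI)
    fix xs assume "xs \<in> pverts (cart_power G (Suc N))"
    then show "xs \<in> {xs. set xs \<subseteq> pverts G \<and> length xs = Suc N}"
      using Suc by (auto simp: relabel_def cart_prod_def)
  next
    fix xs assume "xs \<in> {xs. set xs \<subseteq> pverts G \<and> length xs = Suc N}"
    then show "xs \<in> pverts (cart_power G (Suc N))"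
      using Suc by (cases xs rule: rev_cases) (auto simp: relabel_def cart_prod_def)
  qed
qed auto

lemma pair_graph_cart_prod:
  assumes "pair_graph G" "pair_graph H"
  shows "pair_graph (cart_prod G H)"
proof -
  interpret G: pair_graph G by fact
  interpret H: pair_graph H by fact
  have sG: "(y, x) \<in> parcs G" if "(x, y) \<in> parcs G" for x y
    using that G.pair_sym_arcs by (auto simp: symmetric_def sym_def)
  have sH: "(y, x) \<in> parcs H" if "(x, y) \<in> parcs H" for x y
    using that H.pair_sym_arcs by (auto simp: symmetric_def sym_def)
  have sub: "parcs (cart_prod G H) \<subseteq> pverts (cart_prod G H) \<times> pverts (cart_prod G H)"
    by (auto simp: cart_prod_def dest: G.wellformed' H.wellformed')
  have fin: "finite (pverts (cart_prod G H))"
    by (simp add: cart_prod_def)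
  show ?thesis
  proof
    show "finite (parcs (cart_prod G H))"
      by (rule finite_subset[OF sub]) (simp add: fin)
    show "symmetric (cart_prod G H)"
      by (auto simp: symmetric_def sym_def cart_prod_def intro: sG sH)
    show "fst e \<noteq> snd e" if "e \<in> parcs (cart_prod G H)" for e
      using that G.pair_no_loops H.pair_no_loops by (fastforce simp: cart_prod_def)
  qed (use sub fin in auto)
qed

lemma pair_graph_relabel:
  assumes "pair_graph G" "inj_on f (pverts G)"
  shows "pair_graph (relabel f G)"
proof -
  interpret G: pair_graph G by fact
  have s: "(y, x) \<in> parcs G" if "(x, y) \<in> parcs G" for x y
    using that G.pair_sym_arcs by (auto simp: symmetric_def sym_def)
  show ?thesis
  proof
    show "symmetric (relabel f G)"
    proof -
      have "(b, a) \<in> parcs (relabel f G)" if ab: "(a, b) \<in> parcs (relabel f G)" for a b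
      proof -
        obtain x y where "(x, y) \<in> parcs G" "a = f x" "b = f y"
          using ab by (auto simp: relabel_def)
        then show ?thesis
          using map_prod_imageI[OF s] by (simp add: relabel_def)
      qed
      then show ?thesis
        by (auto simp: symmetric_def sym_def)
    qed
    show "fst e \<noteq> snd e" if "e \<in> parcs (relabel f G)" for e
    proof -
      obtain x y where xy: "(x, y) \<in> parcs G" "e = (f x, f y)"
        using \<open>e \<in> parcs (relabel f G)\<close> by (auto simp: relabel_def)
      then have "x \<noteq> y" "x \<in> pverts G" "y \<in> pverts G"
        using G.pair_no_loops[OF xy(1)] G.wellformed' by auto
      then show ?thesis
        using xy(2) assms(2) by (auto dest: inj_onD)
    qed
  qed (auto simp: relabel_def dest: G.wellformed')
qed

lemma pair_graph_cart_power:
  assumes "pair_graph G"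
  shows "pair_graph (cart_power G N)"
proof (induction N)
  case 0
  show ?case
    by unfold_locales (auto simp: symmetric_def sym_def)
next
  case (Suc N)
  show ?case
    unfolding cart_power.simps
    by (intro pair_graph_relabel pair_graph_cart_prod Suc assms) (auto simp: inj_on_def)
qed

text \<open>A one-vertex graph has a single slice for every \<open>N \<ge> 1\<close>.\<close>

lemma card_slices:
  assumes "pair_graph G" "card (pverts G) \<ge> 2"
  shows "card (slices G N) = N * card (pverts G) ^ (N - 1)"
proof -
  interpret G: pair_graph G by fact
  let ?V = "pverts G"
  let ?L = "\<lambda>n. {xs. set xs \<subseteq> ?V \<and> length xs = n}"
  let ?I = "SIGMA j:{..<N}. ?L j \<times> ?L (N - 1 - j)"
  let ?S = "\<lambda>(j :: nat, us, vs). with_proj (cart_power G N) \<restriction> ((\<lambda>x. us @ x # vs) ` ?V)"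
  obtain a b where ab: "a \<in> ?V" "b \<in> ?V" "a \<noteq> b"
    using assms(2) by (metis G.finite_verts card_2_iff' card_le_Suc0_iff_eq not_less_eq_eq numeral_2_eq_2)
  have "slices G N = ?S ` ?I"
  proof (intro set_eqI iffI)
    fix S assume "S \<in> slices G N"
    then obtain us vs where *: "S = with_proj (cart_power G N) \<restriction> ((\<lambda>x. us @ x # vs) ` ?V)"
      "set us \<subseteq> ?V" "set vs \<subseteq> ?V" "length us + length vs + 1 = N"
      unfolding slices_def by blast
    then have "(length us, us, vs) \<in> ?I" by auto
    then show "S \<in> ?S ` ?I"
      by (rule rev_image_eqI) (simp add: *(1))
  next
    fix S assume "S \<in> ?S ` ?I"
    then show "S \<in> slices G N" by (fastforce simp: slices_def)
  qed
  moreover have "inj_on ?S ?I"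
  proof (rule inj_onI)
    fix p q assume p: "p \<in> ?I" and q: "q \<in> ?I" and eq: "?S p = ?S q"
    obtain j us vs where [simp]: "p = (j, us, vs)" by (cases p)
    obtain k us' vs' where [simp]: "q = (k, us', vs')" by (cases q)
    have len: "length us = j" "length us' = k" using p q by auto
    have img: "(\<lambda>x. us @ x # vs) ` ?V = (\<lambda>x. us' @ x # vs') ` ?V"
      using arg_cong[OF eq, of verts] by (simp add: induce_subgraph_def)
    obtain a' where a': "us @ a # vs = us' @ a' # vs'" using img ab(1) by (metis (no_types, lifting) image_iff)
    obtain b' where b': "us @ b # vs = us' @ b' # vs'" using img ab(2) by (metis (no_types, lifting) image_iff)
    have "j = k"
    proof (rule ccontr)
      assume "j \<noteq> k"
      then have "(us' @ a' # vs') ! j = (us' @ b' # vs') ! j"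
        using len by (auto simp: nth_append nth_Cons split: nat.split)
      then have "(us @ a # vs) ! j = (us @ b # vs) ! j" by (simp only: a' b')
      then show False using len ab by (simp add: nth_append)
    qed
    then show "p = q" using a' len by simp
  qed
  ultimately have "card (slices G N) = card ?I" by (simp add: card_image)
  also have "\<dots> = (\<Sum>j<N. card ?V ^ j * card ?V ^ (N - 1 - j))"
    by (simp add: card_SigmaI card_cartesian_product card_lists_length_eq finite_lists_length_eq)
  also have "\<dots> = (\<Sum>j<N. card ?V ^ (N - 1))"
    by (intro sum.cong) (auto simp flip: power_add)
  finally show ?thesis by simp
qed

end

theory Submission
  imports Defs "HOL-Analysis.Convex" "HOL-Library.NList"
begin

text \<open>
  Given an \<open>r\<close>-colouring of the \<open>N\<close>-th power of \<open>G\<close>, every \<open>G\<close>-slice contains a monochromatic copy of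
  some \<open>G\<^sub>i\<close>; record its type, that is \<open>i\<close>, an embedding \<open>f\<close> of \<open>G\<^sub>i\<close> into \<open>G\<close>, and the colour. The number
  \<open>M\<close> of types does not depend on \<open>N\<close>. Let \<open>n\<close> be so large that the slice density hypothesis applies to
  the \<open>n\<close>-th power of each \<open>G\<^sub>i\<close> with \<open>\<epsilon> = 1 / (2 M)\<close>. For a type with embedding \<open>f\<close>, take a uniformly
  random word \<open>x\<close> of length \<open>N\<close> and a random position in each of \<open>n\<close> long blocks; overwriting \<open>x\<close> at
  these positions by words \<open>f(u)\<close> embeds the \<open>n\<close>-th power of \<open>G\<^sub>i\<close> into that of \<open>G\<close>.

  By the second moment method a uniform random word hardly changes in distribution when a prescribed
  letter is written at a random position of a long block. So a random \<open>G\<^sub>i\<close>-slice of the embedded power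
  has type \<open>t\<close> with almost the same probability as a random \<open>G\<close>-slice, and for some \<open>t\<close> the latter is at
  least \<open>1 / M\<close>. Some embedding therefore has at least an \<open>\<epsilon>\<close>-fraction of its slices of type \<open>t\<close>, and these
  lie in one colour class, which hence contains a copy of \<open>H\<^sub>i\<close>.
\<close>

section \<open>Means over finite sets\<close>

definition mean :: "'a set \<Rightarrow> ('a \<Rightarrow> real) \<Rightarrow> real" where
  "mean A f = (\<Sum>x\<in>A. f x) / real (card A)"

lemma mean_cong: "(\<And>x. x \<in> A \<Longrightarrow> f x = g x) \<Longrightarrow> mean A f = mean A g"
  unfolding mean_def by (metis sum.cong)

lemma mean_mono: "(\<And>x. x \<in> A \<Longrightarrow> f x \<le> g x) \<Longrightarrow> mean A f \<le> mean A g"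
  unfolding mean_def by (simp add: divide_right_mono sum_mono)

lemma mean_const: "finite A \<Longrightarrow> A \<noteq> {} \<Longrightarrow> mean A (\<lambda>_. c) = c"
  by (simp add: mean_def)

lemma mean_add: "mean A (\<lambda>x. f x + g x) = mean A f + mean A g"
  by (simp add: mean_def sum.distrib add_divide_distrib)

lemma mean_diff: "mean A (\<lambda>x. f x - g x) = mean A f - mean A g"
  by (simp add: mean_def sum_subtractf diff_divide_distrib)

lemma mean_mult_left: "mean A (\<lambda>x. c * f x) = c * mean A f"
  by (simp add: mean_def sum_distrib_left)

lemma mean_sum: "mean A (\<lambda>x. \<Sum>i\<in>I. f i x) = (\<Sum>i\<in>I. mean A (f i))"
  unfolding mean_def by (subst sum.swap) (simp add: sum_divide_distrib)

lemma mean_swap: "mean A (\<lambda>x. mean B (f x)) = mean B (\<lambda>y. mean A (\<lambda>x. f x y))"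
  unfolding mean_def by (simp add: sum.swap[of f B A] mult.commute flip: sum_divide_distrib)

lemma mean_Times: "mean (A \<times> B) f = mean A (\<lambda>x. mean B (\<lambda>y. f (x, y)))"
  by (simp add: mean_def card_cartesian_product sum.cartesian_product' mult.commute
      flip: sum_divide_distrib)

lemma mean_image: "inj_on h A \<Longrightarrow> mean (h ` A) f = mean A (\<lambda>x. f (h x))"
  by (simp add: mean_def sum.reindex card_image)

lemma mean_of_bool: "finite A \<Longrightarrow> mean A (\<lambda>x. of_bool (P x)) = real (card {x \<in> A. P x}) / real (card A)"
  by (simp add: mean_def sum_of_bool_eq Int_def)

lemma abs_mean_diff_le:
  assumes "\<And>x. x \<in> A \<Longrightarrow> \<bar>f x - g x\<bar> \<le> \<eta>" "0 \<le> \<eta>"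
  shows "\<bar>mean A f - mean A g\<bar> \<le> \<eta>"
proof (cases "finite A \<and> A \<noteq> {}")
  case True
  have "mean A (\<lambda>x. f x - g x) \<le> mean A (\<lambda>_. \<eta>)" "mean A (\<lambda>_. - \<eta>) \<le> mean A (\<lambda>x. f x - g x)"
    using assms(1) by (force intro!: mean_mono)+
  then show ?thesis
    using True by (simp add: mean_const mean_diff abs_le_iff)
qed (use assms(2) in \<open>auto simp: mean_def\<close>)

lemma mean_square_le: "(mean A f)\<^sup>2 \<le> mean A (\<lambda>x. (f x)\<^sup>2)"
proof (cases "card A = 0")
  case False
  then have "(mean A f)\<^sup>2 \<le> (\<Sum>x\<in>A. (f x)\<^sup>2) * real (card A) / (real (card A))\<^sup>2"
    using sum_squared_le_sum_of_squares[of f A]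
    by (simp add: mean_def power_divide divide_right_mono)
  then show ?thesis
    using False by (simp add: mean_def power2_eq_square)
qed (simp add: mean_def)

lemma ex_mean_le:
  assumes "finite A" "A \<noteq> {}"
  shows "\<exists>x\<in>A. mean A f \<le> f x"
proof (rule ccontr)
  assume "\<not> ?thesis"
  then have "sum f A < real (card A) * mean A f"
    using assms by (intro sum_bounded_above_strict) (auto simp: card_gt_0_iff)
  then show False
    using assms by (simp add: mean_def)
qed

lemma ex_frequent_value:
  assumes "finite A" "A \<noteq> {}" "finite T" "\<And>x. x \<in> A \<Longrightarrow> f x \<in> T"
  shows "\<exists>t\<in>T. 1 / real (card T) \<le> mean A (\<lambda>x. of_bool (f x = t))"
proof -
  have "(\<Sum>t\<in>T. mean A (\<lambda>x. of_bool (f x = t))) = mean A (\<lambda>x. \<Sum>t\<in>T. of_bool (f x = t))"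
    by (rule mean_sum[symmetric])
  also have "\<dots> = mean A (\<lambda>_. 1)"
    using assms(3,4) by (intro mean_cong) (simp add: of_bool_def)
  finally have "mean T (\<lambda>t. mean A (\<lambda>x. of_bool (f x = t))) = 1 / real (card T)"
    using assms(1,2) by (simp add: mean_const mean_def[of T])
  moreover have "T \<noteq> {}"
    using assms(2,4) by blast
  ultimately show ?thesis
    using ex_mean_le[OF assms(3)] by metis
qed

section \<open>Writing a letter at a random position of a random word\<close>

lemma nlists_eq_Collect: "nlists n S = {xs. set xs \<subseteq> S \<and> length xs = n}"
  unfolding nlists_def by blast

lemma finite_nlists: "finite S \<Longrightarrow> finite (nlists n S)"
  unfolding nlists_eq_Collect by (rule finite_lists_length_eq)

lemma card_nlists: "finite S \<Longrightarrow> card (nlists n S) = card S ^ n"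
  unfolding nlists_eq_Collect by (rule card_lists_length_eq)

lemma nlists_eq_empty_iff: "nlists n S = {} \<longleftrightarrow> S = {} \<and> n > 0"
  using nlists_not_empty[of S n] by (cases n) (auto simp: in_nlists_Suc_iff)

lemma map_in_nlists: "xs \<in> nlists n S \<Longrightarrow> f ` S \<subseteq> T \<Longrightarrow> map f xs \<in> nlists n T"
  unfolding nlists_def by auto

lemma mean_nlists_resample:
  assumes "finite S" "j < n"
  shows "mean (nlists n S) (\<lambda>x. mean S (\<lambda>b. g (x[j := b]))) = mean (nlists n S) g"
proof (cases "S = {}")
  case True
  with assms(2) have "nlists n S = {}"
    by (simp add: nlists_eq_empty_iff)
  then show ?thesis
    by (simp add: mean_def)
next
  case False
  have "(\<Sum>(x, b)\<in>nlists n S \<times> S. g (x[j := b])) = (\<Sum>(x, b)\<in>nlists n S \<times> S. g x)"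
    by (rule sum.reindex_bij_witness[where i = "\<lambda>(x, b). (x[j := b], x ! j)"
          and j = "\<lambda>(x, b). (x[j := b], x ! j)"])
      (use assms in \<open>auto simp: nlistsE_nth_in\<close>)
  then have "mean (nlists n S \<times> S) (\<lambda>(x, b). g (x[j := b])) = mean (nlists n S \<times> S) (\<lambda>(x, b). g x)"
    by (simp add: mean_def)
  then show ?thesis
    using assms(1) False by (simp add: mean_Times mean_const)
qed

lemma mean_nlists_update:
  assumes "finite S" "a \<in> S" "j < n"
  shows "mean (nlists n S) (\<lambda>x. f (x[j := a])) =
    mean (nlists n S) (\<lambda>x. real (card S) * of_bool (x ! j = a) * f x)"
proof -
  have "mean S (\<lambda>b. real (card S) * of_bool (x[j := b] ! j = a) * f (x[j := b])) = f (x[j := a])"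
    if "x \<in> nlists n S" for x
  proof -
    have "(\<Sum>b\<in>S. real (card S) * of_bool (x[j := b] ! j = a) * f (x[j := b])) =
        (\<Sum>b\<in>S. if b = a then real (card S) * f (x[j := a]) else 0)"
      using that assms by (intro sum.cong) auto
    then show ?thesis
      using assms by (auto simp: mean_def)
  qed
  then show ?thesis
    using mean_nlists_resample[OF assms(1,3), of "\<lambda>x. real (card S) * of_bool (x ! j = a) * f x"]
    by (simp cong: mean_cong)
qed

text \<open>
  Normalised so that writing \<open>a\<close> at a random position in \<open>J\<close> turns the uniform distribution on words
  into the one with relative density \<open>1 + letter_excess S a J x / card J\<close>.
\<close>

definition letter_excess :: "'a set \<Rightarrow> 'a \<Rightarrow> nat set \<Rightarrow> 'a list \<Rightarrow> real" where
  "letter_excess S a J x = (\<Sum>j\<in>J. real (card S) * of_bool (x ! j = a) - 1)"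

lemma mean_letter_excess_mult:
  assumes "finite S" "a \<in> S" "j < n" "\<And>x. x \<in> nlists n S \<Longrightarrow> h (x[j := a]) = h x"
  shows "mean (nlists n S) (\<lambda>x. letter_excess S a {j} x * h x) = 0"
proof -
  have "mean (nlists n S) (\<lambda>x. h (x[j := a])) = mean (nlists n S) h"
    by (rule mean_cong) (rule assms(4))
  then show ?thesis
    using mean_nlists_update[OF assms(1-3), of h]
    by (simp add: letter_excess_def left_diff_distrib mean_diff)
qed

lemma mean_letter_excess_square:
  assumes S: "finite S" "a \<in> S" and J: "J \<subseteq> {..<n}"
  shows "mean (nlists n S) (\<lambda>x. (letter_excess S a J x)\<^sup>2) = real (card J) * (real (card S) - 1)"
proof -
  let ?q = "real (card S)" and ?X = "nlists n S" and ?d = "\<lambda>j. letter_excess S a {j}"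
  have X: "finite ?X" "?X \<noteq> {}"
    using S by (auto simp: finite_nlists nlists_eq_empty_iff)
  have covariance: "mean ?X (\<lambda>x. ?d j x * ?d k x) = (if k = j then ?q - 1 else 0)"
    if "j \<in> J" "k \<in> J" for j k
  proof (cases "k = j")
    case True
    have "?d j x * ?d j x = (?q - 2) * (?d j x * 1) + (?q - 1)" for x
      by (auto simp: letter_excess_def algebra_simps)
    then show ?thesis
      using True that J S X mean_letter_excess_mult[OF S, of j n "\<lambda>_. 1"]
      by (auto simp: mean_add mean_mult_left mean_const)
  next
    case False
    then show ?thesis
      using that J mean_letter_excess_mult[OF S, of j n "?d k"] by (auto simp: letter_excess_def)
  qed
  have "letter_excess S a J x = (\<Sum>j\<in>J. ?d j x)" for x
    by (simp add: letter_excess_def)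
  then have "mean ?X (\<lambda>x. (letter_excess S a J x)\<^sup>2) = (\<Sum>j\<in>J. \<Sum>k\<in>J. mean ?X (\<lambda>x. ?d j x * ?d k x))"
    by (simp add: power2_eq_square sum_product mean_sum)
  also have "\<dots> = (\<Sum>j\<in>J. \<Sum>k\<in>J. if k = j then ?q - 1 else 0)"
    by (intro sum.cong refl covariance)
  finally show ?thesis
    using finite_subset[OF J] by simp
qed

lemma mean_random_update_close:
  assumes S: "finite S" "a \<in> S" and J: "J \<subseteq> {..<n}" "J \<noteq> {}"
    and f: "\<And>x. \<bar>f x\<bar> \<le> 1" and \<eta>: "0 \<le> \<eta>" "real (card S) \<le> \<eta>\<^sup>2 * real (card J)"
  shows "\<bar>mean J (\<lambda>j. mean (nlists n S) (\<lambda>x. f (x[j := a]))) - mean (nlists n S) f\<bar> \<le> \<eta>"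
    (is "\<bar>?updated - mean ?X f\<bar> \<le> \<eta>")
proof -
  have "finite J"
    using J(1) finite_subset by blast
  with J(2) have m: "0 < real (card J)"
    by (simp add: card_gt_0_iff)
  define E where "E x = letter_excess S a J x / real (card J)" for x
  have "?updated = mean J (\<lambda>j. mean ?X (\<lambda>x. real (card S) * of_bool (x ! j = a) * f x))"
    using S J(1) by (intro mean_cong mean_nlists_update) auto
  also have "\<dots> = mean ?X (\<lambda>x. mean J (\<lambda>j. real (card S) * of_bool (x ! j = a) * f x))"
    by (rule mean_swap)
  also have "\<dots> = mean ?X (\<lambda>x. E x * f x + f x)"
    using m by (simp add: E_def letter_excess_def mean_def[of J] sum_subtractf field_simps
        flip: sum_distrib_right sum_distrib_left)
  finally have "(?updated - mean ?X f)\<^sup>2 = (mean ?X (\<lambda>x. E x * f x))\<^sup>2"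
    by (simp add: mean_add)
  also have "\<dots> \<le> mean ?X (\<lambda>x. (E x * f x)\<^sup>2)"
    by (rule mean_square_le)
  also have "\<dots> \<le> mean ?X (\<lambda>x. (E x)\<^sup>2)"
    using f by (intro mean_mono) (simp add: power_mult_distrib mult_left_le abs_square_le_1)
  also have "\<dots> = mean ?X (\<lambda>x. (letter_excess S a J x)\<^sup>2) / (real (card J))\<^sup>2"
    by (simp add: E_def power_divide mean_def mult.commute flip: sum_divide_distrib)
  also have "\<dots> = (real (card S) - 1) / real (card J)"
    unfolding mean_letter_excess_square[OF S J(1)] using m by (simp add: power2_eq_square)
  also have "\<dots> \<le> \<eta>\<^sup>2"
    using \<eta>(2) m by (simp add: field_simps)
  finally show ?thesis
    using \<eta>(1) by (simp flip: abs_le_square_iff)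
qed

section \<open>Overwriting random words\<close>

definition overwrite :: "nat list \<Rightarrow> 'a list \<Rightarrow> 'a list \<Rightarrow> 'a list" where
  "overwrite ps vs x = foldr (\<lambda>(j, a) y. y[j := a]) (zip ps vs) x"

lemma overwrite_Nil [simp]: "overwrite [] vs x = x" "overwrite ps [] x = x"
  by (simp_all add: overwrite_def)

lemma overwrite_Cons [simp]: "overwrite (p # ps) (v # vs) x = (overwrite ps vs x)[p := v]"
  by (simp add: overwrite_def)

lemma overwrite_snoc:
  "length ps = length vs \<Longrightarrow> overwrite (ps @ [j]) (vs @ [a]) x = overwrite ps vs (x[j := a])"
  by (simp add: overwrite_def)

lemma length_overwrite [simp]: "length (overwrite ps vs x) = length x"
  by (induction ps vs rule: list_induct2') simp_all

lemma overwrite_in_nlists: "x \<in> nlists n S \<Longrightarrow> set vs \<subseteq> S \<Longrightarrow> overwrite ps vs x \<in> nlists n S"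
  by (induction ps vs rule: list_induct2') simp_all

lemma nth_overwrite_other: "j \<notin> set ps \<Longrightarrow> overwrite ps vs x ! j = x ! j"
  by (induction ps vs rule: list_induct2') simp_all

lemma overwrite_list_update:
  "j \<notin> set ps \<Longrightarrow> overwrite ps vs (x[j := a]) = (overwrite ps vs x)[j := a]"
  by (induction ps vs rule: list_induct2') (auto simp: list_update_swap)

lemma overwrite_take_Suc:
  assumes "length ps = length vs" "s < length ps"
  shows "overwrite (take (Suc s) ps) (take (Suc s) vs) x =
    overwrite (take s ps) (take s vs) (x[ps ! s := vs ! s])"
  using assms by (simp add: take_Suc_conv_app_nth overwrite_snoc)

lemma overwrite_take_Suc_distinct:
  assumes "length ps = length vs" "s < length ps" "distinct ps"
  shows "overwrite (take (Suc s) ps) (take (Suc s) vs) x =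
    (overwrite (take s ps) (take s vs) x)[ps ! s := vs ! s]"
proof -
  have "ps ! s \<notin> set (take s ps)"
    using distinct_take[OF assms(3), of "Suc s"] assms(2) by (simp add: take_Suc_conv_app_nth)
  then show ?thesis
    using assms(1,2) by (simp add: overwrite_take_Suc overwrite_list_update)
qed

lemma nth_overwrite:
  assumes "length ps = length vs" "distinct ps" "set ps \<subseteq> {..<length x}" "l < length ps"
  shows "overwrite ps vs x ! (ps ! l) = vs ! l"
  using assms
proof (induction ps vs arbitrary: l rule: list_induct2)
  case (Cons p ps v vs)
  then show ?case
    by (cases l) (auto simp: nth_list_update)
qed simp

lemma overwrite_update:
  assumes "length ps = length vs" "distinct ps" "l < length ps"
  shows "overwrite ps (vs[l := a]) x = (overwrite ps vs x)[ps ! l := a]"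
  using assms
proof (induction ps vs arbitrary: l rule: list_induct2)
  case (Cons p ps v vs)
  then show ?case
    by (cases l) (auto intro: list_update_swap)
qed simp

lemma overwrite_map_in_nlists:
  assumes "x \<in> nlists n T" "u \<in> nlists k S" "f ` S \<subseteq> T"
  shows "overwrite ps (map f u) x \<in> nlists n T"
  by (rule overwrite_in_nlists[OF assms(1) nlistsE_set[OF map_in_nlists[OF assms(2,3)]]])

lemma nth_overwrite_map:
  assumes "distinct ps" "set ps \<subseteq> {..<length x}" "length u = length ps" "l < length ps"
  shows "overwrite ps (map f u) x ! (ps ! l) = f (u ! l)"
  using assms by (simp add: nth_overwrite)

lemma overwrite_map_update:
  assumes "distinct ps" "length u = length ps" "l < length ps"
  shows "overwrite ps (map f (u[l := a])) x = (overwrite ps (map f u) x)[ps ! l := f a]"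
  using assms by (simp add: map_update overwrite_update)

lemma inj_on_overwrite_map:
  assumes ps: "distinct ps" "set ps \<subseteq> {..<length x}" and f: "inj_on f S"
  shows "inj_on (\<lambda>u. overwrite ps (map f u) x) (nlists (length ps) S)"
proof (rule inj_onI)
  fix u v assume u: "u \<in> nlists (length ps) S" and v: "v \<in> nlists (length ps) S"
    and eq: "overwrite ps (map f u) x = overwrite ps (map f v) x"
  show "u = v"
  proof (rule nth_equalityI)
    fix l assume "l < length u"
    then have l: "l < length ps"
      using u by simp
    then have "f (u ! l) = f (v ! l)"
      using nth_overwrite_map[OF ps _ l, of u f] nth_overwrite_map[OF ps _ l, of v f] u v eq by simp
    then show "u ! l = v ! l"
      using inj_onD[OF f] nlistsE_nth_in[OF u l] nlistsE_nth_in[OF v l] by blast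
  qed (use u v in simp)
qed

text \<open>
  The positions \<open>0, \<dots>, n B - 1\<close> are cut into \<open>n\<close> blocks of length \<open>B\<close>; the entry \<open>qs ! l\<close> is an offset
  in block \<open>l\<close>.
\<close>

definition block_positions :: "nat \<Rightarrow> nat list \<Rightarrow> nat list" where
  "block_positions B qs = map (\<lambda>l. l * B + qs ! l) [0..<length qs]"

lemma length_block_positions [simp]: "length (block_positions B qs) = length qs"
  by (simp add: block_positions_def)

lemma nth_block_positions [simp]: "l < length qs \<Longrightarrow> block_positions B qs ! l = l * B + qs ! l"
  by (simp add: block_positions_def)

lemma block_positions_update:
  "block_positions B (qs[s := b]) = (block_positions B qs)[s := s * B + b]"
proof (rule nth_equalityI)
  fix l assume "l < length (block_positions B (qs[s := b]))"
  then show "block_positions B (qs[s := b]) ! l = (block_positions B qs)[s := s * B + b] ! l"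
    by (cases "l = s") simp_all
qed simp

lemma block_offset_less:
  fixes l s B k :: nat
  assumes "l < s" "k < B"
  shows "l * B + k < s * B"
proof -
  have "l * B + k < Suc l * B" using assms by simp
  also have "\<dots> \<le> s * B" using assms by (intro mult_right_mono) auto
  finally show ?thesis .
qed

lemma set_block_positions: "qs \<in> nlists n {..<B} \<Longrightarrow> set (block_positions B qs) \<subseteq> {..<n * B}"
  by (auto simp: block_positions_def intro!: block_offset_less dest: nlistsE_nth_in)

lemma distinct_block_positions:
  assumes "qs \<in> nlists n {..<B}"
  shows "distinct (block_positions B qs)"
proof -
  have "inj_on (\<lambda>l. l * B + qs ! l) {..<n}"
  proof (rule inj_onI)
    fix l s assume "l \<in> {..<n}" "s \<in> {..<n}" and eq: "l * B + qs ! l = s * B + qs ! s"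
    then have "qs ! l < B" "qs ! s < B" "B \<noteq> 0"
      using nlistsE_nth_in[OF assms] by fastforce+
    then show "l = s"
      using arg_cong[OF eq, of "\<lambda>k. k div B"] by simp
  qed
  then show ?thesis
    using assms by (simp add: block_positions_def distinct_map atLeast0LessThan)
qed

text \<open>
  Since \<open>overwrite\<close> writes its last letter first, using \<open>Suc s\<close> letters instead of \<open>s\<close> means writing
  one letter at a random position of a uniform word before all the others.
\<close>

lemma mean_overwrite_take_close:
  fixes g :: "nat \<Rightarrow> 'a list \<Rightarrow> real"
  assumes V: "finite V" and v: "v \<in> nlists n V" and l: "l < n" and N: "n * B \<le> N"
    and g: "\<And>j x. \<bar>g j x\<bar> \<le> 1" "\<And>j x a. g j (x[j := a]) = g j x"
    and \<eta>: "0 \<le> \<eta>" "real (card V) \<le> \<eta>\<^sup>2 * real B" and s: "s < n"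
  defines "written k qs \<equiv> overwrite (take k (block_positions B qs)) (take k v)"
  defines "M k \<equiv> mean (nlists n {..<B}) (\<lambda>qs. mean (nlists N V)
    (\<lambda>x. g (block_positions B qs ! l) (written k qs x)))"
  shows "\<bar>M (Suc s) - M s\<bar> \<le> \<eta>"
proof -
  let ?Q = "nlists n {..<B}" and ?X = "nlists N V" and ?ps = "block_positions B"
  have vs: "v ! s \<in> V"
    using v s by (rule nlistsE_nth_in)
  show ?thesis
  proof (cases "s = l")
    case True
    have "written (Suc s) qs x = (written s qs x)[?ps qs ! l := v ! l]" if "qs \<in> ?Q" for qs x
      using that v l unfolding written_def True
      by (intro overwrite_take_Suc_distinct distinct_block_positions) simp_all
    then have "M (Suc s) = M s"
      unfolding M_def by (intro mean_cong) (simp add: g(2))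
    then show ?thesis
      using \<eta>(1) by simp
  next
    case False
    define f where "f qs x = g (?ps qs ! l) (written s qs x)" for qs x
    have B: "0 < B"
      using vs V \<eta>(2) by (cases B) auto
    have f_resample: "f (qs[s := b]) = f qs" if "qs \<in> ?Q" for qs b
      using that l False by (simp add: fun_eq_iff f_def written_def block_positions_update)
    have "M (Suc s) = mean ?Q (\<lambda>qs. mean ?X (\<lambda>x. f qs (x[s * B + qs ! s := v ! s])))"
      unfolding M_def using v s by (intro mean_cong) (simp add: written_def overwrite_take_Suc f_def)
    also have "\<dots> = mean ?Q (\<lambda>qs. mean {..<B} (\<lambda>b. mean ?X (\<lambda>x. f (qs[s := b]) (x[s * B + qs[s := b] ! s := v ! s]))))"
      using s by (intro mean_nlists_resample[symmetric]) simp_all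
    also have "\<dots> = mean ?Q (\<lambda>qs. mean {..<B} (\<lambda>b. mean ?X (\<lambda>x. f qs (x[s * B + b := v ! s]))))"
      using s by (intro mean_cong) (simp add: f_resample)
    also have "\<dots> = mean ?Q (\<lambda>qs. mean ((+) (s * B) ` {..<B}) (\<lambda>j. mean ?X (\<lambda>x. f qs (x[j := v ! s]))))"
      by (simp add: mean_image)
    also have "\<bar>\<dots> - M s\<bar> \<le> \<eta>"
      unfolding M_def f_def[symmetric]
    proof (intro abs_mean_diff_le mean_random_update_close V vs)
      show "(+) (s * B) ` {..<B} \<subseteq> {..<N}"
        using block_offset_less[OF s] N by fastforce
    qed (use B \<eta> g(1) in \<open>auto simp: f_def card_image\<close>)
    finally show ?thesis .
  qed
qed

lemma mean_overwrite_close: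
  fixes g :: "nat \<Rightarrow> 'a list \<Rightarrow> real"
  assumes "finite V" "v \<in> nlists n V" "l < n" "n * B \<le> N"
    and "\<And>j x. \<bar>g j x\<bar> \<le> 1" "\<And>j x a. g j (x[j := a]) = g j x"
    and "0 \<le> \<eta>" "real (card V) \<le> \<eta>\<^sup>2 * real B"
  shows "\<bar>mean (nlists n {..<B}) (\<lambda>qs. mean (nlists N V)
        (\<lambda>x. g (block_positions B qs ! l) (overwrite (block_positions B qs) v x)))
      - mean (nlists n {..<B}) (\<lambda>qs. mean (nlists N V) (\<lambda>x. g (block_positions B qs ! l) x))\<bar>
    \<le> real n * \<eta>"
proof -
  define M where "M k = mean (nlists n {..<B}) (\<lambda>qs. mean (nlists N V) (\<lambda>x.
      g (block_positions B qs ! l) (overwrite (take k (block_positions B qs)) (take k v) x)))" for k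
  have "\<bar>M k - M 0\<bar> \<le> real k * \<eta>" if "k \<le> n" for k
    using that
  proof (induction k)
    case (Suc k)
    then have "\<bar>M (Suc k) - M k\<bar> \<le> \<eta>"
      unfolding M_def by (intro mean_overwrite_take_close assms) simp_all
    with Suc show ?case
      by (simp add: algebra_simps)
  qed simp
  from this[of n] show ?thesis
    using assms(2) by (simp add: M_def cong: mean_cong)
qed

lemma mean_overwrite_map_ge:
  fixes g :: "nat \<Rightarrow> 'a list \<Rightarrow> real"
  assumes V: "finite V" and S: "finite S" "S \<noteq> {}" "f ` S \<subseteq> V"
    and n: "0 < n" and N: "n * B \<le> N"
    and g: "\<And>j x. \<bar>g j x\<bar> \<le> 1" "\<And>j x a. g j (x[j := a]) = g j x"
    and \<eta>: "0 \<le> \<eta>" "real (card V) \<le> \<eta>\<^sup>2 * real B"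
  shows "mean {..<n} (\<lambda>l. mean (nlists n {..<B}) (\<lambda>qs. mean (nlists N V)
      (g (block_positions B qs ! l)))) - real n * \<eta>
    \<le> mean (nlists n {..<B} \<times> nlists N V) (\<lambda>(qs, x). mean {..<n} (\<lambda>l. mean (nlists n S)
      (\<lambda>v. g (block_positions B qs ! l) (overwrite (block_positions B qs) (map f v) x))))"
proof -
  let ?Q = "nlists n {..<B}" and ?X = "nlists N V" and ?L = "{..<n}" and ?W = "nlists n S"
    and ?ps = "block_positions B"
  have W: "finite ?W" "?W \<noteq> {}"
    using S by (auto simp: finite_nlists nlists_eq_empty_iff)
  have "mean ?Q (\<lambda>qs. mean ?X (g (?ps qs ! l))) - real n * \<eta>
      \<le> mean ?Q (\<lambda>qs. mean ?X (\<lambda>x. g (?ps qs ! l) (overwrite (?ps qs) (map f v) x)))"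
    if "l \<in> ?L" "v \<in> ?W" for l v
    using mean_overwrite_close[OF V map_in_nlists[OF that(2) S(3)] _ N g \<eta>, of l] that(1)
    by (simp add: abs_le_iff)
  then have "mean ?L (\<lambda>l. mean ?W (\<lambda>v. mean ?Q (\<lambda>qs. mean ?X (g (?ps qs ! l))) - real n * \<eta>))
      \<le> mean ?L (\<lambda>l. mean ?W (\<lambda>v. mean ?Q (\<lambda>qs. mean ?X
        (\<lambda>x. g (?ps qs ! l) (overwrite (?ps qs) (map f v) x)))))"
    by (intro mean_mono)
  also have "\<dots> = mean (?L \<times> ?W) (\<lambda>(l, v). mean (?Q \<times> ?X)
      (\<lambda>(qs, x). g (?ps qs ! l) (overwrite (?ps qs) (map f v) x)))"
    by (simp add: mean_Times)
  also have "\<dots> = mean (?Q \<times> ?X) (\<lambda>(qs, x). mean (?L \<times> ?W)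
      (\<lambda>(l, v). g (?ps qs ! l) (overwrite (?ps qs) (map f v) x)))"
    unfolding case_prod_unfold by (rule mean_swap)
  finally show ?thesis
    using n W by (simp add: mean_Times mean_diff mean_const lessThan_empty_iff)
qed

lemma ex_overwrite_dense_type:
  fixes \<tau> :: "nat \<Rightarrow> 'a list \<Rightarrow> 't" and U :: "'t \<Rightarrow> 'b set"
  assumes T: "finite T" and V: "finite V" "V \<noteq> {}"
    and U: "\<And>t. t \<in> T \<Longrightarrow> finite (U t) \<and> U t \<noteq> {} \<and> \<phi> t ` U t \<subseteq> V"
    and n: "0 < n" and N: "n * B \<le> N"
    and \<tau>: "\<And>j x a. \<tau> j (x[j := a]) = \<tau> j x" "\<And>j x. x \<in> nlists N V \<Longrightarrow> \<tau> j x \<in> T"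
    and \<eta>: "0 \<le> \<eta>" "real (card V) \<le> \<eta>\<^sup>2 * real B"
  shows "\<exists>t\<in>T. \<exists>qs\<in>nlists n {..<B}. \<exists>x\<in>nlists N V.
    1 / real (card T) - real n * \<eta> \<le> mean {..<n} (\<lambda>l. mean (nlists n (U t)) (\<lambda>v. of_bool
      (\<tau> (block_positions B qs ! l) (overwrite (block_positions B qs) (map (\<phi> t) v) x) = t)))"
proof -
  let ?Q = "nlists n {..<B}" and ?X = "nlists N V" and ?L = "{..<n}" and ?ps = "block_positions B"
  have "0 < card V"
    using V by (simp add: card_gt_0_iff)
  then have "0 < B"
    using \<eta>(2) by (cases B) auto
  then have fin: "finite ?Q" "?Q \<noteq> {}" "finite ?X" "?X \<noteq> {}"
    using V by (auto simp: finite_nlists nlists_eq_empty_iff)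
  have "\<exists>t\<in>T. 1 / real (card T) \<le> mean (?L \<times> ?Q \<times> ?X)
      (\<lambda>lqx. of_bool ((case lqx of (l, qs, x) \<Rightarrow> \<tau> (?ps qs ! l) x) = t))"
    using fin n T \<tau>(2) by (intro ex_frequent_value) (auto simp: lessThan_empty_iff)
  then obtain t where t: "t \<in> T" and frequent:
      "1 / real (card T) \<le> mean ?L (\<lambda>l. mean ?Q (\<lambda>qs. mean ?X (\<lambda>x. of_bool (\<tau> (?ps qs ! l) x = t))))"
    by (auto simp: mean_Times)
  let ?density = "\<lambda>(qs, x). mean ?L (\<lambda>l. mean (nlists n (U t)) (\<lambda>v. of_bool
    (\<tau> (?ps qs ! l) (overwrite (?ps qs) (map (\<phi> t) v) x) = t)))"
  have "1 / real (card T) - real n * \<eta> \<le> mean (?Q \<times> ?X) ?density"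
    using frequent mean_overwrite_map_ge[of V "U t" "\<phi> t" n B N "\<lambda>j x. of_bool (\<tau> j x = t)" \<eta>]
      U[OF t] V n N \<tau>(1) \<eta> by simp
  moreover obtain qs x where "qs \<in> ?Q" "x \<in> ?X" "mean (?Q \<times> ?X) ?density \<le> ?density (qs, x)"
    using ex_mean_le[of "?Q \<times> ?X" ?density] fin by blast
  ultimately show ?thesis
    using t by (intro bexI[of _ t] bexI[of _ qs] bexI[of _ x]) simp_all
qed

definition line_density :: "'a set \<Rightarrow> nat \<Rightarrow> 'a list set \<Rightarrow> real" where
  "line_density S n X = mean {..<n} (\<lambda>l. mean (nlists n S) (\<lambda>v. of_bool (\<forall>a\<in>S. v[l := a] \<in> X)))"

lemma ex_line_types:
  assumes ramsey: "\<And>d. d \<in> V \<rightarrow> C \<Longrightarrow> \<exists>t\<in>T. \<forall>a\<in>U t. d (\<phi> t a) = \<kappa> t"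
    and c: "c \<in> nlists N V \<rightarrow> C"
  shows "\<exists>\<tau>. (\<forall>j x a. \<tau> j (x[j := a]) = \<tau> j x) \<and> (\<forall>j. \<forall>x\<in>nlists N V.
    \<tau> j x \<in> T \<and> (\<forall>a\<in>U (\<tau> j x). c (x[j := \<phi> (\<tau> j x) a]) = \<kappa> (\<tau> j x)))"
proof -
  define \<tau> where "\<tau> j x = (SOME t. t \<in> T \<and> (\<forall>a\<in>U t. c (x[j := \<phi> t a]) = \<kappa> t))" for j x
  have "\<tau> j (x[j := a]) = \<tau> j x" for j x a
    by (simp add: \<tau>_def)
  moreover have "\<tau> j x \<in> T \<and> (\<forall>a\<in>U (\<tau> j x). c (x[j := \<phi> (\<tau> j x) a]) = \<kappa> (\<tau> j x))"
    if "x \<in> nlists N V" for j x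
  proof -
    have "(\<lambda>a. c (x[j := a])) \<in> V \<rightarrow> C"
      using c that by auto
    from ramsey[OF this] have "\<exists>t. t \<in> T \<and> (\<forall>a\<in>U t. c (x[j := \<phi> t a]) = \<kappa> t)"
      by blast
    then show ?thesis
      unfolding \<tau>_def by (rule someI_ex)
  qed
  ultimately show ?thesis
    by blast
qed

lemma ex_overwrite_dense_monochromatic:
  fixes \<phi> :: "'t \<Rightarrow> 'b \<Rightarrow> 'a" and C :: "'k set"
  assumes T: "finite T" and V: "finite V" "V \<noteq> {}"
    and U: "\<And>t. t \<in> T \<Longrightarrow> finite (U t) \<and> U t \<noteq> {} \<and> \<phi> t ` U t \<subseteq> V"
    and ramsey: "\<And>d. d \<in> V \<rightarrow> C \<Longrightarrow> \<exists>t\<in>T. \<forall>a\<in>U t. d (\<phi> t a) = \<kappa> t"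
    and n: "0 < n" and N: "n * B \<le> N" and \<eta>: "0 \<le> \<eta>" "real (card V) \<le> \<eta>\<^sup>2 * real B"
    and c: "c \<in> nlists N V \<rightarrow> C"
  shows "\<exists>t\<in>T. \<exists>ps. \<exists>x\<in>nlists N V. length ps = n \<and> distinct ps \<and> set ps \<subseteq> {..<N} \<and>
    1 / real (card T) - real n * \<eta> \<le> line_density (U t) n {u. c (overwrite ps (map (\<phi> t) u) x) = \<kappa> t}"
proof -
  obtain \<tau> where \<tau>: "\<And>j x a. \<tau> j (x[j := a]) = \<tau> j x" "\<And>j x. x \<in> nlists N V \<Longrightarrow> \<tau> j x \<in> T"
    and mono: "\<And>j x a. x \<in> nlists N V \<Longrightarrow> a \<in> U (\<tau> j x) \<Longrightarrow> c (x[j := \<phi> (\<tau> j x) a]) = \<kappa> (\<tau> j x)"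
    using ex_line_types[where U = U and \<phi> = \<phi> and \<kappa> = \<kappa>, OF ramsey c] by blast
  obtain t qs x where t: "t \<in> T" and qs: "qs \<in> nlists n {..<B}" and x: "x \<in> nlists N V"
    and dense: "1 / real (card T) - real n * \<eta> \<le> mean {..<n} (\<lambda>l. mean (nlists n (U t)) (\<lambda>v. of_bool
      (\<tau> (block_positions B qs ! l) (overwrite (block_positions B qs) (map (\<phi> t) v) x) = t)))"
    using ex_overwrite_dense_type[where U = U and \<phi> = \<phi>, OF T V U n N \<tau> \<eta>] by blast
  define ps where "ps = block_positions B qs"
  have ps: "length ps = n" "distinct ps" "set ps \<subseteq> {..<N}"
    using qs set_block_positions[OF qs] N distinct_block_positions[OF qs] by (auto simp: ps_def)
  have "c (overwrite ps (map (\<phi> t) (v[l := a])) x) = \<kappa> t"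
    if "l < n" and v: "v \<in> nlists n (U t)" and "\<tau> (ps ! l) (overwrite ps (map (\<phi> t) v) x) = t" "a \<in> U t"
    for l v a
  proof -
    have "overwrite ps (map (\<phi> t) v) x \<in> nlists N V"
      using U[OF t] by (intro overwrite_map_in_nlists[OF x v]) simp
    from mono[OF this, of a "ps ! l"] show ?thesis
      using that ps by (simp add: overwrite_map_update)
  qed
  then have "1 / real (card T) - real n * \<eta> \<le>
      line_density (U t) n {u. c (overwrite ps (map (\<phi> t) u) x) = \<kappa> t}"
    using dense unfolding line_density_def ps_def[symmetric]
    by (elim order_trans) (intro mean_mono, simp add: of_bool_def)
  then show ?thesis
    using t x ps by blast
qed

lemma eventually_ex_overwrite_dense_monochromatic:
  fixes \<phi> :: "'t \<Rightarrow> 'b \<Rightarrow> 'a" and C :: "'k set"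
  assumes T: "finite T" "T \<noteq> {}" and V: "finite V"
    and U: "\<And>t. t \<in> T \<Longrightarrow> finite (U t) \<and> U t \<noteq> {} \<and> \<phi> t ` U t \<subseteq> V"
    and ramsey: "\<And>d. d \<in> V \<rightarrow> C \<Longrightarrow> \<exists>t\<in>T. \<forall>a\<in>U t. d (\<phi> t a) = \<kappa> t"
    and n: "0 < n"
  shows "\<forall>\<^sub>F N in sequentially. \<forall>c\<in>nlists N V \<rightarrow> C. \<exists>t\<in>T. \<exists>ps. \<exists>x\<in>nlists N V.
    length ps = n \<and> distinct ps \<and> set ps \<subseteq> {..<N} \<and>
    1 / (2 * real (card T)) \<le> line_density (U t) n {u. c (overwrite ps (map (\<phi> t) u) x) = \<kappa> t}"
proof -
  define \<eta> where "\<eta> = 1 / (2 * real n * real (card T))"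
  have \<eta>: "0 < \<eta>" "1 / real (card T) - real n * \<eta> = 1 / (2 * real (card T))"
    using n T by (simp_all add: \<eta>_def card_gt_0_iff field_simps)
  obtain B where "real (card V) / \<eta>\<^sup>2 < real B"
    using reals_Archimedean2 by blast
  then have B: "real (card V) \<le> \<eta>\<^sup>2 * real B"
    using \<eta>(1) by (simp add: field_simps)
  have "V \<noteq> {}"
    using T(2) U by blast
  then show ?thesis
    using ex_overwrite_dense_monochromatic[where U = U and \<phi> = \<phi> and \<kappa> = \<kappa>,
        OF T(1) V _ U ramsey n _ less_imp_le[OF \<eta>(1)] B]
    unfolding \<eta>(2) by (intro eventually_sequentiallyI[of "n * B"] ballI) blast
qed

section \<open>Embeddings and copies\<close>

text \<open>
  The flag \<open>ind\<close> selects induced embeddings, so that both halves of the theorem share one proof.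
\<close>

definition embedding ::
  "bool \<Rightarrow> ('b \<Rightarrow> 'a) \<Rightarrow> 'b pair_pre_digraph \<Rightarrow> 'a pair_pre_digraph \<Rightarrow> bool" where
  "embedding ind f H G \<longleftrightarrow> inj_on f (pverts H) \<and> f ` pverts H \<subseteq> pverts G \<and>
    (\<forall>u\<in>pverts H. \<forall>v\<in>pverts H. ((u, v) \<in> parcs H \<longrightarrow> (f u, f v) \<in> parcs G) \<and>
      (ind \<longrightarrow> (f u, f v) \<in> parcs G \<longrightarrow> (u, v) \<in> parcs H))"

lemma embedding_cong:
  assumes "\<And>v. v \<in> pverts H \<Longrightarrow> f v = g v"
  shows "embedding ind f H G \<longleftrightarrow> embedding ind g H G"
  using assms by (simp add: embedding_def cong: inj_on_cong image_cong)

lemma embedding_comp: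
  assumes "embedding ind f H K" "embedding ind g K G"
  shows "embedding ind (g \<circ> f) H G"
proof -
  have "inj_on (g \<circ> f) (pverts H)"
    using assms unfolding embedding_def by (meson comp_inj_on inj_on_subset)
  moreover have "f v \<in> pverts K" if "v \<in> pverts H" for v
    using assms(1) that by (auto simp: embedding_def)
  ultimately show ?thesis
    using assms unfolding embedding_def o_apply image_subset_iff by blast
qed

lemma embedding_null_graph: "pverts H = {} \<Longrightarrow> embedding ind f H G"
  by (simp add: embedding_def)

lemma digraph_iso_pair_iff:
  assumes "pair_wf_digraph H"
  shows "digraph_iso (with_proj H) (with_proj C) \<longleftrightarrow> (\<exists>f. inj_on f (pverts H) \<and> C = relabel f H)"
proof
  assume "digraph_iso (with_proj H) (with_proj C)"
  then obtain h where h: "pre_digraph.digraph_isomorphism H h" and C: "with_proj C = app_iso h H"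
    by (auto simp: digraph_iso_def)
  have "iso_tail h = fst" "iso_head h = snd"
    using arg_cong[OF C, of tail] arg_cong[OF C, of head] by simp_all
  then have "iso_arcs h a = map_prod (iso_verts h) (iso_verts h) a" if "a \<in> parcs H" for a
    using pre_digraph.iso_verts_tail[OF h, of a] pre_digraph.iso_verts_head[OF h, of a] that
    by (simp add: prod_eq_iff)
  then have "C = relabel (iso_verts h) H"
    using arg_cong[OF C, of verts] arg_cong[OF C, of arcs] by (simp add: relabel_def)
  moreover have "inj_on (iso_verts h) (pverts H)"
    using pre_digraph.digraph_isomorphism_inj_on_verts[OF h] by simp
  ultimately show "\<exists>f. inj_on f (pverts H) \<and> C = relabel f H"
    by blast
next
  assume "\<exists>f. inj_on f (pverts H) \<and> C = relabel f H"
  then obtain f where f: "inj_on f (pverts H)" "C = relabel f H"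
    by blast
  let ?h = "\<lparr>iso_verts = f, iso_arcs = map_prod f f, iso_head = snd, iso_tail = fst\<rparr>"
  have "parcs H \<subseteq> pverts H \<times> pverts H"
    using assms by (auto simp: pair_wf_digraph_def)
  then have "inj_on (map_prod f f) (parcs H)"
    using f map_prod_inj_on inj_on_subset by blast
  then have "pre_digraph.digraph_isomorphism H ?h"
    using assms f by (simp add: pre_digraph.digraph_isomorphism_def wf_digraph_wp_iff)
  moreover have "with_proj C = app_iso ?h H"
    using f by (simp add: app_iso_def with_proj_def relabel_def)
  ultimately show "digraph_iso (with_proj H) (with_proj C)"
    unfolding digraph_iso_def by blast
qed

lemma subgraph_relabel_iff:
  assumes "pair_wf_digraph H" "pair_wf_digraph G" "inj_on f (pverts H)"
  shows "subgraph (relabel f H) G \<longleftrightarrow> embedding False f H G"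
proof -
  interpret H: pair_wf_digraph H by fact
  have "wf_digraph (relabel f H)"
    using H.wellformed' by (auto simp: wf_digraph_wp_iff pair_wf_digraph_def relabel_def)
  moreover have "map_prod f f ` parcs H \<subseteq> parcs G \<longleftrightarrow>
      (\<forall>u\<in>pverts H. \<forall>v\<in>pverts H. (u, v) \<in> parcs H \<longrightarrow> (f u, f v) \<in> parcs G)"
    using H.wellformed' by (fastforce simp: image_subset_iff)
  ultimately show ?thesis
    using assms(2,3) unfolding subgraph_def wf_digraph_wp_iff embedding_def
    by (auto simp: relabel_def)
qed

lemma induced_subgraph_relabel_iff:
  assumes "pair_wf_digraph H" "pair_wf_digraph G" "inj_on f (pverts H)"
  shows "induced_subgraph (relabel f H) G \<longleftrightarrow> embedding True f H G"
proof -
  interpret H: pair_wf_digraph H by fact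
  have "(f u, f v) \<in> map_prod f f ` parcs H \<longleftrightarrow> (u, v) \<in> parcs H"
    if "u \<in> pverts H" "v \<in> pverts H" for u v
  proof
    assume "(f u, f v) \<in> map_prod f f ` parcs H"
    then obtain a b where ab: "(a, b) \<in> parcs H" "f u = f a" "f v = f b"
      by auto
    then have "u = a" "v = b"
      using that H.wellformed'[OF ab(1)] inj_onD[OF assms(3)] by blast+
    with ab(1) show "(u, v) \<in> parcs H"
      by simp
  qed (auto intro: map_prod_imageI)
  then have "embedding True f H G \<longleftrightarrow> embedding False f H G \<and>
      (\<forall>u\<in>pverts H. \<forall>v\<in>pverts H. (f u, f v) \<in> parcs G \<longrightarrow> (f u, f v) \<in> parcs (relabel f H))"
    unfolding embedding_def relabel_def by auto
  moreover have "parcs (relabel f H) \<subseteq> f ` pverts H \<times> f ` pverts H"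
    using H.wellformed' by (auto simp: relabel_def)
  then have "induced_subgraph (relabel f H) G \<longleftrightarrow> subgraph (relabel f H) G \<and>
      (\<forall>u\<in>pverts H. \<forall>v\<in>pverts H. (f u, f v) \<in> parcs G \<longrightarrow> (f u, f v) \<in> parcs (relabel f H))"
    unfolding induced_subgraph_def subgraph_def by (auto simp: relabel_def)
  ultimately show ?thesis
    unfolding subgraph_relabel_iff[OF assms] by blast
qed

lemma ex_is_copy_iff_ex_embedding:
  assumes "pair_wf_digraph H" "pair_wf_digraph G"
  shows "(\<exists>C. is_copy C H G \<and> P C) \<longleftrightarrow> (\<exists>f. embedding False f H G \<and> P (relabel f H))"
proof -
  have "is_copy C H G \<longleftrightarrow> (\<exists>f. embedding False f H G \<and> C = relabel f H)" for C
    unfolding is_copy_def digraph_iso_pair_iff[OF assms(1)]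
    using subgraph_relabel_iff[OF assms] by (auto simp: embedding_def)
  then show ?thesis
    by (simp only:) blast
qed

lemma ex_is_induced_copy_iff_ex_embedding:
  assumes "pair_wf_digraph H" "pair_wf_digraph G"
  shows "(\<exists>C. is_induced_copy C H G \<and> P C) \<longleftrightarrow> (\<exists>f. embedding True f H G \<and> P (relabel f H))"
proof -
  have "is_induced_copy C H G \<longleftrightarrow> (\<exists>f. embedding True f H G \<and> C = relabel f H)" for C
    unfolding is_induced_copy_def digraph_iso_pair_iff[OF assms(1)]
    using induced_subgraph_relabel_iff[OF assms] by (auto simp: embedding_def)
  then show ?thesis
    by (simp only:) blast
qed

definition pair_induce :: "'a pair_pre_digraph \<Rightarrow> 'a set \<Rightarrow> 'a pair_pre_digraph" where
  "pair_induce G X = \<lparr>pverts = X, parcs = {e \<in> parcs G. fst e \<in> X \<and> snd e \<in> X}\<rparr>"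

lemma with_proj_pair_induce: "with_proj (pair_induce G X) = with_proj G \<restriction> X"
  by (simp add: pair_induce_def induce_subgraph_def with_proj_def)

lemma (in pair_graph) pair_graph_pair_induce:
  assumes "X \<subseteq> pverts G"
  shows "pair_graph (pair_induce G X)"
proof (rule pair_graphI_graph)
  have "induced_subgraph (pair_induce G X) G"
    using induced_induce[OF assms] by (simp add: with_proj_pair_induce)
  then have "digraph (pair_induce G X)" "sym_digraph (pair_induce G X)"
    by (rule digraphI_induced, rule induced_graph_imp_graph)
  then interpret X: digraph "pair_induce G X" + X: sym_digraph "pair_induce G X" .
  show "graph (pair_induce G X)"
    by unfold_locales (rule X.sym_arcs)
qed

lemma (in pair_wf_digraph) subgraph_pair_induce: "X \<subseteq> pverts G \<Longrightarrow> subgraph (pair_induce G X) G"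
  unfolding with_proj_pair_induce by (rule subgraph_induce_subgraphI)

lemma embedding_pair_induce: "X \<subseteq> pverts G \<Longrightarrow> embedding ind id (pair_induce G X) G"
  by (auto simp: embedding_def pair_induce_def)

section \<open>Embedding powers into powers\<close>

lemma pverts_cart_power_eq_nlists: "pverts (cart_power G N) = nlists N (pverts G)"
  unfolding pverts_cart_power nlists_eq_Collect ..

lemma snoc_arc_cart_power_Suc_iff:
  "(xs @ [a], ys @ [b]) \<in> parcs (cart_power G (Suc N)) \<longleftrightarrow>
    (xs, ys) \<in> parcs (cart_power G N) \<and> a = b \<and> a \<in> pverts G \<or>
    xs = ys \<and> xs \<in> nlists N (pverts G) \<and> (a, b) \<in> parcs G"
proof -
  have "(xs @ [a], ys @ [b]) \<in> parcs (cart_power G (Suc N)) \<longleftrightarrow>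
      ((xs, a), (ys, b)) \<in> parcs (cart_prod (cart_power G N) G)"
    by (force simp: relabel_def)
  then show ?thesis
    by (simp add: cart_prod_def pverts_cart_power_eq_nlists conj_ac)
qed

lemma in_nlists_SucE_snoc:
  assumes "x \<in> nlists (Suc n) S"
  obtains xs a where "x = xs @ [a]" "xs \<in> nlists n S" "a \<in> S"
  using assms unfolding nlists_def by (cases x rule: rev_cases) auto

lemma arc_cart_power_iff:
  assumes "x \<in> nlists N (pverts G)" "y \<in> nlists N (pverts G)"
  shows "(x, y) \<in> parcs (cart_power G N) \<longleftrightarrow> (\<exists>j<N. (x ! j, y ! j) \<in> parcs G \<and> y = x[j := y ! j])"
  using assms
proof (induction N arbitrary: x y)
  case (Suc N)
  obtain xs a where x: "x = xs @ [a]" "xs \<in> nlists N (pverts G)" "a \<in> pverts G"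
    using Suc.prems(1) by (auto elim!: in_nlists_SucE_snoc)
  obtain ys b where y: "y = ys @ [b]" "ys \<in> nlists N (pverts G)" "b \<in> pverts G"
    using Suc.prems(2) by (auto elim!: in_nlists_SucE_snoc)
  have "(\<exists>j<Suc N. (x ! j, y ! j) \<in> parcs G \<and> y = x[j := y ! j]) \<longleftrightarrow>
      (\<exists>j<N. (xs ! j, ys ! j) \<in> parcs G \<and> ys = xs[j := ys ! j]) \<and> a = b \<or> xs = ys \<and> (a, b) \<in> parcs G"
    using x y by (auto simp: Ex_less_Suc nth_append list_update_append)
  moreover have "(x, y) \<in> parcs (cart_power G (Suc N)) \<longleftrightarrow>
      (xs, ys) \<in> parcs (cart_power G N) \<and> a = b \<or> xs = ys \<and> (a, b) \<in> parcs G"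
    unfolding x(1) y(1) snoc_arc_cart_power_Suc_iff using x(2,3) by blast
  ultimately show ?case
    using Suc.IH[OF x(2) y(2)] by simp
qed simp

lemma arc_cart_power_overwrite:
  assumes f: "embedding ind f F G" and ps: "distinct ps" "set ps \<subseteq> {..<N}"
    and x: "x \<in> nlists N (pverts G)"
    and u: "u \<in> nlists (length ps) (pverts F)" and v: "v \<in> nlists (length ps) (pverts F)"
    and arc: "(u, v) \<in> parcs (cart_power F (length ps))"
  shows "(overwrite ps (map f u) x, overwrite ps (map f v) x) \<in> parcs (cart_power G N)"
proof -
  let ?\<psi> = "\<lambda>u. overwrite ps (map f u) x"
  have f_in: "f ` pverts F \<subseteq> pverts G"
    using f by (simp add: embedding_def)
  obtain l where l: "l < length ps" "(u ! l, v ! l) \<in> parcs F" "v = u[l := v ! l]"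
    using arc unfolding arc_cart_power_iff[OF u v] by blast
  have nth: "?\<psi> u ! (ps ! l) = f (u ! l)" "?\<psi> v ! (ps ! l) = f (v ! l)"
    using u v x ps l(1) by (auto intro!: nth_overwrite_map)
  have "(f (u ! l), f (v ! l)) \<in> parcs G"
    using f l(2) nlistsE_nth_in[OF u l(1)] nlistsE_nth_in[OF v l(1)] unfolding embedding_def by blast
  moreover have "?\<psi> v = (?\<psi> u)[ps ! l := f (v ! l)]"
    using overwrite_map_update[OF ps(1) _ l(1), of u f "v ! l" x] u l(3) by simp
  moreover have "ps ! l < N"
    using ps(2) l(1) nth_mem by blast
  ultimately show ?thesis
    unfolding arc_cart_power_iff[OF overwrite_map_in_nlists[OF x u f_in] overwrite_map_in_nlists[OF x v f_in]]
    using nth by metis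
qed

lemma arc_cart_power_overwriteD:
  assumes f: "embedding True f F G" and G: "pair_loopfree_digraph G"
    and ps: "distinct ps" "set ps \<subseteq> {..<N}" and x: "x \<in> nlists N (pverts G)"
    and u: "u \<in> nlists (length ps) (pverts F)" and v: "v \<in> nlists (length ps) (pverts F)"
    and arc: "(overwrite ps (map f u) x, overwrite ps (map f v) x) \<in> parcs (cart_power G N)"
  shows "(u, v) \<in> parcs (cart_power F (length ps))"
proof -
  let ?\<psi> = "\<lambda>u. overwrite ps (map f u) x"
  have f_in: "f ` pverts F \<subseteq> pverts G" and f_inj: "inj_on f (pverts F)"
    using f by (simp_all add: embedding_def)
  obtain j where j: "(?\<psi> u ! j, ?\<psi> v ! j) \<in> parcs G" "?\<psi> v = (?\<psi> u)[j := ?\<psi> v ! j]"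
    using arc
    unfolding arc_cart_power_iff[OF overwrite_map_in_nlists[OF x u f_in] overwrite_map_in_nlists[OF x v f_in]]
    by blast
  have "?\<psi> u ! j \<noteq> ?\<psi> v ! j"
    using pair_loopfree_digraph.pair_no_loops[OF G j(1)] by simp
  then have "j \<in> set ps"
    by (metis nth_overwrite_other)
  then obtain l where l: "l < length ps" "j = ps ! l"
    by (metis in_set_conv_nth)
  have nth: "?\<psi> u ! j = f (u ! l)" "?\<psi> v ! j = f (v ! l)"
    using u v x ps l by (auto intro!: nth_overwrite_map)
  have "?\<psi> (u[l := v ! l]) = ?\<psi> v"
    using overwrite_map_update[OF ps(1) _ l(1), of u f "v ! l" x] u j(2) nth(2) l(2) by simp
  moreover have "inj_on ?\<psi> (nlists (length ps) (pverts F))"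
    using ps x by (intro inj_on_overwrite_map f_inj) simp_all
  ultimately have "v = u[l := v ! l]"
    using u v nlistsE_nth_in[OF v l(1)] by (metis inj_onD nlists_update_in_list)
  moreover have "(u ! l, v ! l) \<in> parcs F"
    using f j(1) nlistsE_nth_in[OF u l(1)] nlistsE_nth_in[OF v l(1)] unfolding nth embedding_def by blast
  ultimately show ?thesis
    unfolding arc_cart_power_iff[OF u v] using l(1) by blast
qed

lemma embedding_overwrite:
  assumes f: "embedding ind f F G" and G: "pair_loopfree_digraph G"
    and ps: "distinct ps" "set ps \<subseteq> {..<N}" and x: "x \<in> nlists N (pverts G)"
  shows "embedding ind (\<lambda>u. overwrite ps (map f u) x) (cart_power F (length ps)) (cart_power G N)"
proof -
  have "inj_on (\<lambda>u. overwrite ps (map f u) x) (nlists (length ps) (pverts F))"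
    using ps x f by (intro inj_on_overwrite_map) (simp_all add: embedding_def)
  moreover have "overwrite ps (map f u) x \<in> nlists N (pverts G)"
    if "u \<in> nlists (length ps) (pverts F)" for u
    using f by (intro overwrite_map_in_nlists[OF x that]) (simp add: embedding_def)
  moreover have "(u, v) \<in> parcs (cart_power F (length ps))"
    if ind "u \<in> nlists (length ps) (pverts F)" "v \<in> nlists (length ps) (pverts F)"
      "(overwrite ps (map f u) x, overwrite ps (map f v) x) \<in> parcs (cart_power G N)" for u v
    using arc_cart_power_overwriteD[OF _ G ps x that(2-4)] f that(1) by simp
  ultimately show ?thesis
    using arc_cart_power_overwrite[OF f ps x]
    unfolding embedding_def[of _ _ "cart_power F (length ps)"] pverts_cart_power_eq_nlists
    by (simp add: image_subset_iff)
qed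

section \<open>Slice density and arrow relations\<close>

definition line_slice ::
  "'a pair_pre_digraph \<Rightarrow> nat \<Rightarrow> nat \<times> 'a list \<Rightarrow> ('a list, 'a list \<times> 'a list) pre_digraph" where
  "line_slice G n = (\<lambda>(l, v). with_proj (cart_power G n) \<restriction> ((\<lambda>a. v[l := a]) ` pverts G))"

lemma line_slice_update: "line_slice G n (l, v[l := a]) = line_slice G n (l, v)"
  by (simp add: line_slice_def)

lemma slices_eq_line_slices:
  assumes "pverts G \<noteq> {}"
  shows "slices G n = line_slice G n ` ({..<n} \<times> nlists n (pverts G))"
proof (intro equalityI subsetI)
  fix S assume "S \<in> slices G n"
  then obtain us vs where S: "S = with_proj (cart_power G n) \<restriction> ((\<lambda>x. us @ x # vs) ` pverts G)"
      "set us \<subseteq> pverts G" "set vs \<subseteq> pverts G" "length us + length vs + 1 = n"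
    unfolding slices_def by blast
  obtain b where "b \<in> pverts G"
    using assms by blast
  then have "us @ b # vs \<in> nlists n (pverts G)"
    using S(2-4) by (intro nlistsI) auto
  moreover have "length us < n"
    using S(4) by simp
  moreover have "S = line_slice G n (length us, us @ b # vs)"
    by (simp add: S(1) line_slice_def)
  ultimately show "S \<in> line_slice G n ` ({..<n} \<times> nlists n (pverts G))"
    by (intro image_eqI[where x = "(length us, us @ b # vs)"]) simp_all
next
  fix S assume "S \<in> line_slice G n ` ({..<n} \<times> nlists n (pverts G))"
  then obtain l v where lv: "l < n" "v \<in> nlists n (pverts G)" and S: "S = line_slice G n (l, v)"
    by blast
  let ?us = "take l v" and ?vs = "drop (Suc l) v"
  have "(\<lambda>a. v[l := a]) = (\<lambda>a. ?us @ a # ?vs)"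
    using lv by (simp add: upd_conv_take_nth_drop)
  then have "S = with_proj (cart_power G n) \<restriction> ((\<lambda>a. ?us @ a # ?vs) ` pverts G)"
    by (simp add: S line_slice_def)
  moreover have "set ?us \<subseteq> pverts G" "set ?vs \<subseteq> pverts G"
    using nlistsE_set[OF lv(2)] set_take_subset[of l v] set_drop_subset[of "Suc l" v] by blast+
  moreover have "length ?us + length ?vs + 1 = n"
    using lv by simp
  ultimately show "S \<in> slices G n"
    unfolding slices_def by blast
qed

lemma finite_slices:
  assumes "finite (pverts G)"
  shows "finite (slices G n)"
proof (cases "pverts G = {}")
  case False
  then show ?thesis
    using assms by (simp add: slices_eq_line_slices finite_nlists)
qed (auto simp: slices_def)

definition slices_within ::
  "'a pair_pre_digraph \<Rightarrow> nat \<Rightarrow> 'a list set \<Rightarrow> ('a list, 'a list \<times> 'a list) pre_digraph set" where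
  "slices_within G n X = {S \<in> slices G n. subgraph S (pair_induce (cart_power G n) X)}"

lemma line_slice_in_slices_within:
  assumes G: "pair_graph G" "pverts G \<noteq> {}" and lv: "l < n" "v \<in> nlists n (pverts G)"
    and line: "\<And>a. a \<in> pverts G \<Longrightarrow> v[l := a] \<in> X"
  shows "line_slice G n (l, v) \<in> slices_within G n X"
proof -
  interpret Gn: pair_graph "cart_power G n"
    by (rule pair_graph_cart_power) fact
  have "subgraph (line_slice G n (l, v)) (pair_induce (cart_power G n) X)"
    using line Gn.wellformed_induce_subgraph
    by (auto simp: with_proj_pair_induce line_slice_def subgraph_def compatible_def)
  then show ?thesis
    using lv by (auto simp: slices_within_def slices_eq_line_slices[OF G(2)])
qed

text \<open>
  With at least two vertices a slice determines its direction, and its vertices, paired with that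
  direction, account for all pairs of a direction and a vertex exactly once.
\<close>

lemma ex_bij_betw_slices_lines:
  assumes G: "pair_graph G" "card (pverts G) \<ge> 2"
  shows "\<exists>h. bij_betw h (slices G n \<times> pverts G) ({..<n} \<times> nlists n (pverts G)) \<and>
    (\<forall>S\<in>slices G n. \<forall>a\<in>pverts G. line_slice G n (h (S, a)) = S)"
proof -
  interpret G: pair_graph G by fact
  let ?L = "{..<n} \<times> nlists n (pverts G)"
  have slices: "slices G n = line_slice G n ` ?L"
    using G(2) by (intro slices_eq_line_slices) auto
  define rep where "rep = inv_into ?L (line_slice G n)"
  have rep: "rep S \<in> ?L" "line_slice G n (rep S) = S" if "S \<in> slices G n" for S
    using that unfolding rep_def slices by (rule inv_into_into, rule f_inv_into_f)
  define h where "h = (\<lambda>(S, a). (fst (rep S), (snd (rep S))[fst (rep S) := a]))"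
  have h_slice: "line_slice G n (h (S, a)) = S" if "S \<in> slices G n" for S a
    using rep(2)[OF that] by (simp add: h_def line_slice_update)
  have "inj_on h (slices G n \<times> pverts G)"
  proof (rule inj_onI, clarify)
    fix S a S' a' assume S: "S \<in> slices G n" "S' \<in> slices G n" and eq: "h (S, a) = h (S', a')"
    then have "S = S'"
      using h_slice by metis
    obtain l v where "rep S = (l, v)" "l < n" "v \<in> nlists n (pverts G)"
      using rep(1)[OF S(1)] by auto
    with eq \<open>S = S'\<close> have "v[l := a] ! l = v[l := a'] ! l" "l < length v"
      by (auto simp: h_def)
    with \<open>S = S'\<close> show "S = S' \<and> a = a'"
      by simp
  qed
  moreover have "h ` (slices G n \<times> pverts G) = ?L"
  proof (rule card_subset_eq)
    show "h ` (slices G n \<times> pverts G) \<subseteq> ?L"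
      using rep(1) by (fastforce simp: h_def)
    have "card (h ` (slices G n \<times> pverts G)) = n * card (pverts G) ^ (n - 1) * card (pverts G)"
      using \<open>inj_on h _\<close> by (simp add: card_image card_cartesian_product card_slices[OF G])
    also have "\<dots> = card ?L"
      by (cases n) (simp_all add: card_cartesian_product card_nlists algebra_simps)
    finally show "card (h ` (slices G n \<times> pverts G)) = card ?L" .
  qed (simp add: finite_nlists)
  ultimately show ?thesis
    using h_slice by (auto simp: bij_betw_def)
qed

lemma line_density_eq_card:
  assumes "finite S"
  shows "line_density S n X = real (card {(l, v). l < n \<and> v \<in> nlists n S \<and> (\<forall>a\<in>S. v[l := a] \<in> X)}) /
    real (card ({..<n} \<times> nlists n S))"
proof -
  have "line_density S n X = mean ({..<n} \<times> nlists n S) (\<lambda>lv. of_bool (\<forall>a\<in>S. (snd lv)[fst lv := a] \<in> X))"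
    by (simp add: line_density_def mean_Times)
  also have "\<dots> = real (card {lv \<in> {..<n} \<times> nlists n S. \<forall>a\<in>S. (snd lv)[fst lv := a] \<in> X}) /
      real (card ({..<n} \<times> nlists n S))"
    using assms by (intro mean_of_bool) (simp add: finite_nlists)
  also have "{lv \<in> {..<n} \<times> nlists n S. \<forall>a\<in>S. (snd lv)[fst lv := a] \<in> X} =
      {(l, v). l < n \<and> v \<in> nlists n S \<and> (\<forall>a\<in>S. v[l := a] \<in> X)}"
    by auto
  finally show ?thesis .
qed

lemma line_density_Int: "line_density S n (X \<inter> nlists n S) = line_density S n X"
  by (simp add: line_density_def cong: mean_cong)

lemma line_density_mult_card_slices_le:
  assumes G: "pair_graph G" "card (pverts G) \<ge> 2"
  shows "line_density (pverts G) n X * real (card (slices G n)) \<le> real (card (slices_within G n X))"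
proof -
  interpret G: pair_graph G by fact
  let ?U = "pverts G" and ?L = "{..<n} \<times> nlists n (pverts G)" and ?within = "slices_within G n X"
  define lines where "lines = {(l, v). l < n \<and> v \<in> nlists n ?U \<and> (\<forall>a\<in>?U. v[l := a] \<in> X)}"
  obtain h where h: "bij_betw h (slices G n \<times> ?U) ?L"
    and h_slice: "\<And>S a. S \<in> slices G n \<Longrightarrow> a \<in> ?U \<Longrightarrow> line_slice G n (h (S, a)) = S"
    using ex_bij_betw_slices_lines[OF G] by blast
  have "lines \<subseteq> h ` (?within \<times> ?U)"
  proof
    fix lv assume lv: "lv \<in> lines"
    then have "lv \<in> ?L"
      by (auto simp: lines_def)
    then obtain S a where S: "S \<in> slices G n" "a \<in> ?U" "lv = h (S, a)"
      using bij_betw_imp_surj_on[OF h] by blast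
    moreover have "line_slice G n lv \<in> ?within"
      using lv S(2) by (auto simp: lines_def intro!: line_slice_in_slices_within G)
    ultimately show "lv \<in> h ` (?within \<times> ?U)"
      using h_slice by simp
  qed
  moreover have "finite ?within"
    by (simp add: slices_within_def finite_slices)
  ultimately have "card lines \<le> card (?within \<times> ?U)"
    by (intro surj_card_le) auto
  then have "real (card lines) \<le> real (card ?within) * real (card ?U)"
    by (simp add: card_cartesian_product flip: of_nat_mult)
  moreover have "card ?L = card (slices G n) * card ?U"
    using bij_betw_same_card[OF h] by (simp add: card_cartesian_product)
  ultimately show ?thesis
    using G(2) by (auto simp: line_density_eq_card lines_def field_simps)
qed

lemma card_slices_le_1:
  assumes "pverts G = {a}"
  shows "card (slices G n) \<le> 1"
proof -
  have "line_slice G n (l, replicate n a) = with_proj (cart_power G n) \<restriction> {replicate n a}" if "l < n" for l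
  proof -
    have "(replicate n a)[l := a] = replicate n a"
      using that by (simp add: list_update_same_conv)
    then show ?thesis
      by (simp add: line_slice_def assms)
  qed
  moreover have "slices G n = line_slice G n ` ({..<n} \<times> {replicate n a})"
    using slices_eq_line_slices[of G n] by (simp add: assms nlists_singleton)
  ultimately have "slices G n \<subseteq> {with_proj (cart_power G n) \<restriction> {replicate n a}}"
    by auto
  from card_mono[OF _ this] show ?thesis
    by simp
qed

lemma slices_within_nonempty:
  assumes "pair_graph G" "pverts G \<noteq> {}" "0 < line_density (pverts G) n X"
  shows "slices_within G n X \<noteq> {}"
proof -
  interpret pair_graph G by fact
  have "{(l, v). l < n \<and> v \<in> nlists n (pverts G) \<and> (\<forall>a\<in>pverts G. v[l := a] \<in> X)} \<noteq> {}"
    using assms(3) unfolding line_density_eq_card[OF pair_finite_verts] by force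
  then show ?thesis
    using line_slice_in_slices_within[OF assms(1,2)] by blast
qed

lemma contains_slice_fraction_pair_induce:
  assumes G: "pair_graph G" "pverts G \<noteq> {}" and \<epsilon>: "0 < \<epsilon>" "\<epsilon> \<le> 1"
    and dense: "\<epsilon> \<le> line_density (pverts G) n X"
  shows "contains_slice_fraction \<epsilon> G n (pair_induce (cart_power G n) X)"
proof -
  interpret G: pair_graph G by fact
  have "\<epsilon> * real (card (slices G n)) \<le> real (card (slices_within G n X))"
  proof (cases "card (pverts G) \<ge> 2")
    case True
    then show ?thesis
      using line_density_mult_card_slices_le[OF G(1) True, of n X]
        mult_right_mono[OF dense, of "real (card (slices G n))"] by simp
  next
    case False
    then have "card (pverts G) = 1"
      using G(2) card_gt_0_iff[of "pverts G"] by simp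
    then have "card (slices G n) \<le> 1"
      using card_slices_le_1 by (metis card_1_singletonE)
    then have "\<epsilon> * real (card (slices G n)) \<le> 1 * 1"
      using \<epsilon> by (intro mult_mono) auto
    moreover have "0 < card (slices_within G n X)"
      using slices_within_nonempty[OF G] \<epsilon>(1) dense
      by (simp add: card_gt_0_iff slices_within_def finite_slices)
    ultimately show ?thesis
      by simp
  qed
  then show ?thesis
    by (simp add: contains_slice_fraction_def slices_within_def)
qed

definition slice_fraction_forces ::
  "bool \<Rightarrow> real \<Rightarrow> 'a pair_pre_digraph \<Rightarrow> nat \<Rightarrow> 'b pair_pre_digraph \<Rightarrow> bool" where
  "slice_fraction_forces ind \<epsilon> G N H \<longleftrightarrow>
    (\<forall>K. pair_graph K \<and> subgraph K (cart_power G N) \<and> contains_slice_fraction \<epsilon> G N K \<longrightarrow>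
      (\<exists>f. embedding ind f H K))"

definition slice_density_zero :: "bool \<Rightarrow> 'a pair_pre_digraph \<Rightarrow> 'b pair_pre_digraph \<Rightarrow> bool" where
  "slice_density_zero ind G H \<longleftrightarrow>
    (\<forall>\<epsilon>>0. \<forall>\<^sub>F N in sequentially. slice_fraction_forces ind \<epsilon> G N H)"

definition vertex_arrows :: "bool \<Rightarrow> nat \<Rightarrow> 'a pair_pre_digraph \<Rightarrow> 'b pair_pre_digraph set \<Rightarrow> bool" where
  "vertex_arrows ind r G \<F> \<longleftrightarrow>
    (\<forall>c \<in> pverts G \<rightarrow> {1..r}. \<exists>H\<in>\<F>. \<exists>f. embedding ind f H G \<and> (\<exists>k\<in>{1..r}. \<forall>v\<in>pverts H. c (f v) = k))"

lemma pair_graph_imp_pair_wf_digraph: "pair_graph G \<Longrightarrow> pair_wf_digraph G"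
  by (simp add: pair_graph_def pair_digraph_def pair_fin_digraph_def)

lemma finite_pverts: "pair_graph G \<Longrightarrow> finite (pverts G)"
  by (simp add: pair_graph_def pair_digraph_def pair_fin_digraph.pair_finite_verts)

lemma zero_slice_density_iff:
  fixes G :: "'a pair_pre_digraph" and H :: "'b pair_pre_digraph"
  assumes "pair_graph H"
  shows "zero_slice_density G H \<longleftrightarrow> slice_density_zero False G H"
    and "zero_induced_slice_density G H \<longleftrightarrow> slice_density_zero True G H"
proof -
  have "(\<exists>C. is_copy C H K) \<longleftrightarrow> (\<exists>f. embedding False f H K)"
    and "(\<exists>C. is_induced_copy C H K) \<longleftrightarrow> (\<exists>f. embedding True f H K)"
    if "pair_graph K" for K :: "'a list pair_pre_digraph"
    using that assms
    using ex_is_copy_iff_ex_embedding[of H K "\<lambda>_. True"]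
      ex_is_induced_copy_iff_ex_embedding[of H K "\<lambda>_. True"]
    by (simp_all add: pair_graph_imp_pair_wf_digraph)
  then show "zero_slice_density G H \<longleftrightarrow> slice_density_zero False G H"
    and "zero_induced_slice_density G H \<longleftrightarrow> slice_density_zero True G H"
    unfolding zero_slice_density_def zero_induced_slice_density_def slice_density_zero_def
      slice_fraction_forces_def eventually_sequentially
    by (simp_all cong: conj_cong imp_cong)
qed

lemma arrows_iff_vertex_arrows:
  assumes "pair_graph G" "\<And>H. H \<in> \<F> \<Longrightarrow> pair_graph H"
  shows "arrows r G \<F> \<longleftrightarrow> vertex_arrows False r G \<F>"
    and "induced_arrows r G \<F> \<longleftrightarrow> vertex_arrows True r G \<F>"
proof -
  have "(\<exists>C. is_copy C H G \<and> (\<exists>k\<in>{1..r}. \<forall>v\<in>pverts C. c v = k)) \<longleftrightarrow>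
      (\<exists>f. embedding False f H G \<and> (\<exists>k\<in>{1..r}. \<forall>v\<in>pverts H. c (f v) = k))"
    and "(\<exists>C. is_induced_copy C H G \<and> (\<exists>k\<in>{1..r}. \<forall>v\<in>pverts C. c v = k)) \<longleftrightarrow>
      (\<exists>f. embedding True f H G \<and> (\<exists>k\<in>{1..r}. \<forall>v\<in>pverts H. c (f v) = k))"
    if "H \<in> \<F>" for H c
    using assms(1) assms(2)[OF that]
      ex_is_copy_iff_ex_embedding[of H G "\<lambda>C. \<exists>k\<in>{1..r}. \<forall>v\<in>pverts C. c v = k"]
      ex_is_induced_copy_iff_ex_embedding[of H G "\<lambda>C. \<exists>k\<in>{1..r}. \<forall>v\<in>pverts C. c v = k"]
    by (simp_all add: pair_graph_imp_pair_wf_digraph relabel_def)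
  then show "arrows r G \<F> \<longleftrightarrow> vertex_arrows False r G \<F>"
    and "induced_arrows r G \<F> \<longleftrightarrow> vertex_arrows True r G \<F>"
    unfolding arrows_def induced_arrows_def vertex_arrows_def by (simp_all cong: bex_cong)
qed

lemma null_graph_of_slice_density_zero:
  assumes "slice_density_zero ind G H" "pair_graph G" "pverts G = {}"
  shows "pverts H = {}"
proof -
  have "\<forall>\<^sub>F N in sequentially. slice_fraction_forces ind 1 G N H"
    using assms(1) by (simp add: slice_density_zero_def)
  from eventually_happens'[OF sequentially_bot eventually_conj[OF eventually_ge_at_top[of 2] this]]
  obtain N where N: "2 \<le> N" "slice_fraction_forces ind 1 G N H"
    by blast
  interpret GN: pair_graph "cart_power G N"
    by (rule pair_graph_cart_power) (rule assms(2))
  have "slices G N = {}"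
    using assms(3) N(1) by (auto simp: slices_def)
  then have "contains_slice_fraction 1 G N (pair_induce (cart_power G N) {})"
    by (simp add: contains_slice_fraction_def)
  then obtain f where "embedding ind f H (pair_induce (cart_power G N) {})"
    using N(2) GN.pair_graph_pair_induce[of "{}"] GN.subgraph_pair_induce[of "{}"]
    unfolding slice_fraction_forces_def by blast
  then show ?thesis
    by (simp add: embedding_def pair_induce_def)
qed

lemma ex_monochromatic_embedding:
  assumes F: "pair_graph F" "pverts F \<noteq> {}" and G: "pair_graph G" and f: "embedding ind f F G"
    and ps: "distinct ps" "set ps \<subseteq> {..<N}" and x: "x \<in> nlists N (pverts G)"
    and \<epsilon>: "0 < \<epsilon>" "\<epsilon> \<le> 1" and dense: "\<epsilon> \<le> line_density (pverts F) (length ps) {u. c (overwrite ps (map f u) x) = k}"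
    and H: "slice_fraction_forces ind \<epsilon> F (length ps) H"
  shows "\<exists>h. embedding ind h H (cart_power G N) \<and> (\<forall>v\<in>pverts H. c (h v) = k)"
proof -
  let ?P = "cart_power F (length ps)"
  define \<psi> where "\<psi> u = overwrite ps (map f u) x" for u
  define X where "X = {u. c (\<psi> u) = k} \<inter> nlists (length ps) (pverts F)"
  interpret G: pair_graph G by fact
  interpret P: pair_graph ?P
    by (rule pair_graph_cart_power) (rule F(1))
  have X: "X \<subseteq> pverts ?P"
    by (simp add: X_def pverts_cart_power_eq_nlists)
  have "contains_slice_fraction \<epsilon> F (length ps) (pair_induce ?P X)"
    using dense by (intro contains_slice_fraction_pair_induce F \<epsilon>) (simp add: X_def \<psi>_def line_density_Int)
  then obtain g where g: "embedding ind g H (pair_induce ?P X)"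
    using H P.pair_graph_pair_induce[OF X] P.subgraph_pair_induce[OF X]
    unfolding slice_fraction_forces_def by blast
  have "embedding ind \<psi> ?P (cart_power G N)"
    unfolding \<psi>_def by (intro embedding_overwrite f ps x G.pair_loopfree_digraph_axioms)
  then have "embedding ind (\<psi> \<circ> g) H (cart_power G N)"
    using embedding_comp[OF embedding_comp[OF g embedding_pair_induce[OF X]]] by simp
  moreover have "c ((\<psi> \<circ> g) v) = k" if "v \<in> pverts H" for v
    using g that by (auto simp: embedding_def pair_induce_def X_def)
  ultimately show ?thesis
    by blast
qed

definition coloured_embeddings ::
  "bool \<Rightarrow> nat \<Rightarrow> 'a pair_pre_digraph \<Rightarrow> ('i \<Rightarrow> 'b pair_pre_digraph) \<Rightarrow> 'i set \<Rightarrow> ('i \<times> ('b \<Rightarrow> 'a) \<times> nat) set"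
  where "coloured_embeddings ind r G Gs I =
    {(i, f, k). i \<in> I \<and> f \<in> extensional (pverts (Gs i)) \<and> embedding ind f (Gs i) G \<and> k \<in> {1..r}}"

lemma finite_coloured_embeddings:
  assumes "finite I" "pair_graph G" "\<And>i. i \<in> I \<Longrightarrow> pair_graph (Gs i)"
  shows "finite (coloured_embeddings ind r G Gs I)"
proof (rule finite_subset)
  show "coloured_embeddings ind r G Gs I \<subseteq>
      (SIGMA i:I. (pverts (Gs i) \<rightarrow>\<^sub>E pverts G) \<times> {1..r})"
    by (auto simp: coloured_embeddings_def embedding_def PiE_def)
  show "finite (SIGMA i:I. (pverts (Gs i) \<rightarrow>\<^sub>E pverts G) \<times> {1..r})"
    using assms by (intro finite_SigmaI finite_cartesian_product finite_PiE)
      (simp_all add: finite_pverts)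
qed

lemma ex_coloured_embedding:
  assumes "vertex_arrows ind r G (Gs ` I)" "d \<in> pverts G \<rightarrow> {1..r}"
  shows "\<exists>(i, f, k)\<in>coloured_embeddings ind r G Gs I. \<forall>a\<in>pverts (Gs i). d (f a) = k"
proof -
  obtain i f k where "i \<in> I" "embedding ind f (Gs i) G" "k \<in> {1..r}" "\<forall>a\<in>pverts (Gs i). d (f a) = k"
    using assms unfolding vertex_arrows_def by blast
  then show ?thesis
    using embedding_cong[of "Gs i" f "restrict f (pverts (Gs i))" ind G]
    by (intro bexI[of _ "(i, restrict f (pverts (Gs i)), k)"]) (auto simp: coloured_embeddings_def)
qed

lemma vertex_arrows_cart_power:
  assumes G: "pair_graph G" and Gs: "\<And>i. i \<in> I \<Longrightarrow> pair_graph (Gs i)" "\<And>i. i \<in> I \<Longrightarrow> pverts (Gs i) \<noteq> {}"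
    and \<epsilon>: "0 < \<epsilon>" "\<epsilon> \<le> 1" and forces: "\<And>i. i \<in> I \<Longrightarrow> slice_fraction_forces ind \<epsilon> (Gs i) n (Hs i)"
    and dense: "\<And>c. c \<in> nlists N (pverts G) \<rightarrow> {1..r} \<Longrightarrow>
      \<exists>(i, f, k)\<in>coloured_embeddings ind r G Gs I. \<exists>ps. \<exists>x\<in>nlists N (pverts G).
        length ps = n \<and> distinct ps \<and> set ps \<subseteq> {..<N} \<and>
        \<epsilon> \<le> line_density (pverts (Gs i)) n {u. c (overwrite ps (map f u) x) = k}"
  shows "vertex_arrows ind r (cart_power G N) (Hs ` I)"
  unfolding vertex_arrows_def
proof
  fix c assume "c \<in> pverts (cart_power G N) \<rightarrow> {1..r}"
  then obtain i f k ps x where "(i, f, k) \<in> coloured_embeddings ind r G Gs I"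
    and x: "x \<in> nlists N (pverts G)" and ps: "length ps = n" "distinct ps" "set ps \<subseteq> {..<N}"
    and c_dense: "\<epsilon> \<le> line_density (pverts (Gs i)) n {u. c (overwrite ps (map f u) x) = k}"
    using dense unfolding pverts_cart_power_eq_nlists by blast
  then have i: "i \<in> I" and f: "embedding ind f (Gs i) G" and k: "k \<in> {1..r}"
    by (simp_all add: coloured_embeddings_def)
  have "\<exists>h. embedding ind h (Hs i) (cart_power G N) \<and> (\<forall>v\<in>pverts (Hs i). c (h v) = k)"
    using c_dense forces[OF i] unfolding ps(1)[symmetric]
    by (rule ex_monochromatic_embedding[OF Gs[OF i] G f ps(2,3) x \<epsilon>])
  then show "\<exists>H\<in>Hs ` I. \<exists>f. embedding ind f H (cart_power G N) \<and>
      (\<exists>k\<in>{1..r}. \<forall>v\<in>pverts H. c (f v) = k)"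
    using i k by blast
qed

lemma eventually_vertex_arrows_cart_power_nonnull:
  fixes Gs :: "'i \<Rightarrow> 'a pair_pre_digraph" and Hs :: "'i \<Rightarrow> 'b pair_pre_digraph"
  assumes r: "r \<ge> 1" and I: "finite I" and G: "pair_graph G"
    and Gs: "\<And>i. i \<in> I \<Longrightarrow> pair_graph (Gs i)" "\<And>i. i \<in> I \<Longrightarrow> pverts (Gs i) \<noteq> {}"
    and dens: "\<And>i. i \<in> I \<Longrightarrow> slice_density_zero ind (Gs i) (Hs i)"
    and arr: "vertex_arrows ind r G (Gs ` I)"
  shows "\<forall>\<^sub>F N in sequentially. vertex_arrows ind r (cart_power G N) (Hs ` I)"
proof -
  interpret G: pair_graph G by fact
  define T where "T = coloured_embeddings ind r G Gs I"
  define \<epsilon> where "\<epsilon> = 1 / (2 * real (card T))"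
  let ?U = "\<lambda>t. pverts (Gs (fst t))" and ?f = "\<lambda>t. fst (snd t)" and ?k = "\<lambda>t. snd (snd t)"
  have ramsey: "\<exists>t\<in>T. \<forall>a\<in>?U t. d (?f t a) = ?k t" if "d \<in> pverts G \<rightarrow> {1..r}" for d
    using ex_coloured_embedding[OF arr that] unfolding T_def case_prod_unfold .
  have T: "finite T" "T \<noteq> {}"
    using finite_coloured_embeddings[OF I G Gs(1)] ramsey[of "\<lambda>_. 1"] r by (auto simp: T_def)
  then have "1 \<le> real (card T)"
    by (simp add: Suc_le_eq card_gt_0_iff)
  then have \<epsilon>: "0 < \<epsilon>" "\<epsilon> \<le> 1"
    by (simp_all add: \<epsilon>_def)
  then have "\<forall>\<^sub>F n in sequentially. \<forall>i\<in>I. slice_fraction_forces ind \<epsilon> (Gs i) n (Hs i)"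
    using dens I by (intro eventually_ball_finite) (auto simp: slice_density_zero_def)
  from eventually_happens'[OF sequentially_bot eventually_conj[OF eventually_gt_at_top[of 0] this]]
  obtain n where n: "0 < n" and forces: "\<And>i. i \<in> I \<Longrightarrow> slice_fraction_forces ind \<epsilon> (Gs i) n (Hs i)"
    by blast
  have U: "finite (?U t) \<and> ?U t \<noteq> {} \<and> ?f t ` ?U t \<subseteq> pverts G" if "t \<in> T" for t
    using that Gs by (auto simp: T_def coloured_embeddings_def embedding_def finite_pverts)
  have "\<forall>\<^sub>F N in sequentially. \<forall>c\<in>nlists N (pverts G) \<rightarrow> {1..r}.
      \<exists>(i, f, k)\<in>T. \<exists>ps. \<exists>x\<in>nlists N (pverts G). length ps = n \<and> distinct ps \<and> set ps \<subseteq> {..<N} \<and>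
        \<epsilon> \<le> line_density (pverts (Gs i)) n {u. c (overwrite ps (map f u) x) = k}"
    unfolding \<epsilon>_def case_prod_unfold
    by (rule eventually_ex_overwrite_dense_monochromatic[OF T G.pair_finite_verts U ramsey n])
  then show ?thesis
    by (rule eventually_mono) (auto simp: T_def intro!: vertex_arrows_cart_power[OF G Gs \<epsilon> forces])
qed

lemma eventually_vertex_arrows_cart_power:
  assumes r: "r \<ge> 1" and I: "finite I" and G: "pair_graph G"
    and Gs: "\<And>i. i \<in> I \<Longrightarrow> pair_graph (Gs i)"
    and dens: "\<And>i. i \<in> I \<Longrightarrow> slice_density_zero ind (Gs i) (Hs i)"
    and arr: "vertex_arrows ind r G (Gs ` I)"
  shows "\<forall>\<^sub>F N in sequentially. vertex_arrows ind r (cart_power G N) (Hs ` I)"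
proof (cases "\<exists>i\<in>I. pverts (Gs i) = {}")
  case True
  then obtain i where "i \<in> I" "pverts (Hs i) = {}"
    using null_graph_of_slice_density_zero[OF dens Gs] by blast
  then have "vertex_arrows ind r (cart_power G N) (Hs ` I)" for N
    using r embedding_null_graph[of "Hs i" ind] unfolding vertex_arrows_def by fastforce
  then show ?thesis
    by simp
next
  case False
  then show ?thesis
    using eventually_vertex_arrows_cart_power_nonnull[OF r I G Gs _ dens arr] by blast
qed

theorem theorem1p2:
  fixes r m :: nat
    and Gs :: "nat \<Rightarrow> 'a pair_pre_digraph"
    and Hs :: "nat \<Rightarrow> 'b pair_pre_digraph"
    and G :: "'c pair_pre_digraph"
  assumes "r \<ge> 1"
    and "\<And>i. i \<in> {1..m} \<Longrightarrow> pair_graph (Gs i)"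
    and "\<And>i. i \<in> {1..m} \<Longrightarrow> pair_graph (Hs i)"
    and "pair_graph G"
  shows "((\<forall>i\<in>{1..m}. zero_slice_density (Gs i) (Hs i)) \<and> arrows r G (Gs ` {1..m}) \<longrightarrow>
           (\<exists>N0. \<forall>N\<ge>N0. arrows r (cart_power G N) (Hs ` {1..m}))) \<and>
         ((\<forall>i\<in>{1..m}. zero_induced_slice_density (Gs i) (Hs i)) \<and>
           induced_arrows r G (Gs ` {1..m}) \<longrightarrow>
           (\<exists>N0. \<forall>N\<ge>N0. induced_arrows r (cart_power G N) (Hs ` {1..m})))"
proof -
  have "\<exists>N0. \<forall>N\<ge>N0. vertex_arrows ind r (cart_power G N) (Hs ` {1..m})"
    if "\<forall>i\<in>{1..m}. slice_density_zero ind (Gs i) (Hs i)" "vertex_arrows ind r G (Gs ` {1..m})" for ind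
    using that assms by (intro eventually_vertex_arrows_cart_power[unfolded eventually_sequentially]) auto
  moreover have "pair_graph F" if "F \<in> Gs ` {1..m}" for F
    using assms(2) that by blast
  moreover have "pair_graph F" if "F \<in> Hs ` {1..m}" for F
    using assms(3) that by blast
  ultimately show ?thesis
    using assms(3,4)
    by (simp add: zero_slice_density_iff arrows_iff_vertex_arrows pair_graph_cart_power)
qed

end
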